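(* Let $U,U'\in\mathcal G$ be distant, let $\lambda:U\to U'$ be a $K$-linear isomorphism, let $R=\operatorname{End}_K(U)$, and let $\Phi:\mathbb P(R)\to\mathcal G$, $R(\alpha,\beta)\mapsto\{u^\alpha+u^{\beta\lambda}\mid u\in U\}$. Then the images under $\Phi$ of the $Z$-chains of the chain geometry $\Sigma(Z,R)$ are exactly the $Z$-reguli in $\mathcal G$.
   Context: $K$ is a (not necessarily commutative) field with centre $Z$, and $V$ is a left vector space over $K$ of arbitrary (possibly infinite) dimension with $\dim V>2$. $\mathcal G:=\{X\le V\mid X\cong V/X\}$, assumed nonempty. Points are $1$-dimensional and lines $2$-dimensional subspaces; two subspaces meet if they have a common point. $X,Y\in\mathcal G$ are distant if $V=X\oplus Y$. A $Z$-regulus is a subset $\mathcal R\subseteq\mathcal G$ such that (R1) its elements are mutually distant and $|\mathcal R|\ge3$; (R2) if a line meets three mutually distinct elements of $\mathcal R$ then it meets all elements of $\mathcal R$; (R3) $\mathcal R$ is not properly contained in any subset of $\mathcal G$ satisfying (R1) and (R2). Maps are written as exponents on the right, $u^{\beta\lambda}=(u^\beta)^\lambda$; $\Phi$ is a well-defined bijection. For a ring $S$ with $1$, $\mathrm{GL}(2,S)$ acts on the free left module $S^2$ (row vectors times matrices on the right) and on its submodules; $\mathbb P(S)$ is the orbit of $S(1,0)$. With $Z$ embedded in $R$ via $a\mapsto a\cdot\mathrm{id}_U$, $\mathbb P(Z)$ embeds in $\mathbb P(R)$ via $Z(x,y)\mapsto R(x\cdot\mathrm{id},y\cdot\mathrm{id})$;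 the $Z$-chains are the images of this embedded $\mathbb P(Z)$ under $\mathrm{GL}(2,R)$, and the chain geometry $\Sigma(Z,R)$ is the incidence structure with point set $\mathbb P(R)$ and block set the $Z$-chains. *)

theory Defs
  imports Main
begin

definition left_vs :: "('k::division_ring \<Rightarrow> 'v::ab_group_add \<Rightarrow> 'v) \<Rightarrow> bool" where
  "left_vs sm \<longleftrightarrow>
     (\<forall>a x y. sm a (x + y) = sm a x + sm a y) \<and>
     (\<forall>a b x. sm (a + b) x = sm a x + sm b x) \<and>
     (\<forall>a b x. sm a (sm b x) = sm (a * b) x) \<and>
     (\<forall>x. sm 1 x = x)"

definition subspace :: "('k::division_ring \<Rightarrow> 'v::ab_group_add \<Rightarrow> 'v) \<Rightarrow> 'v set \<Rightarrow> bool" where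
  "subspace sm X \<longleftrightarrow> 0 \<in> X \<and> (\<forall>x\<in>X. \<forall>y\<in>X. x + y \<in> X) \<and> (\<forall>a. \<forall>x\<in>X. sm a x \<in> X)"

definition span :: "('k::division_ring \<Rightarrow> 'v::ab_group_add \<Rightarrow> 'v) \<Rightarrow> 'v set \<Rightarrow> 'v set" where
  "span sm S = \<Inter>{X. subspace sm X \<and> S \<subseteq> X}"

definition lin_indep :: "('k::division_ring \<Rightarrow> 'v::ab_group_add \<Rightarrow> 'v) \<Rightarrow> 'v set \<Rightarrow> bool" where
  "lin_indep sm S \<longleftrightarrow>
     (\<forall>F c. finite F \<and> F \<subseteq> S \<and> (\<Sum>x\<in>F. sm (c x) x) = 0 \<longrightarrow> (\<forall>x\<in>F. c x = 0))"

definition dim_gt2 :: "('k::division_ring \<Rightarrow> 'v::ab_group_add \<Rightarrow> 'v) \<Rightarrow> bool" where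
  "dim_gt2 sm \<longleftrightarrow> (\<exists>S. finite S \<and> card S = 3 \<and> lin_indep sm S)"

definition is_point :: "('k::division_ring \<Rightarrow> 'v::ab_group_add \<Rightarrow> 'v) \<Rightarrow> 'v set \<Rightarrow> bool" where
  "is_point sm P \<longleftrightarrow> (\<exists>S. finite S \<and> card S = 1 \<and> lin_indep sm S \<and> P = span sm S)"

definition is_line :: "('k::division_ring \<Rightarrow> 'v::ab_group_add \<Rightarrow> 'v) \<Rightarrow> 'v set \<Rightarrow> bool" where
  "is_line sm L \<longleftrightarrow> (\<exists>S. finite S \<and> card S = 2 \<and> lin_indep sm S \<and> L = span sm S)"

definition meets :: "('k::division_ring \<Rightarrow> 'v::ab_group_add \<Rightarrow> 'v) \<Rightarrow> 'v set \<Rightarrow> 'v set \<Rightarrow> bool" where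
  "meets sm X Y \<longleftrightarrow> (\<exists>P. is_point sm P \<and> P \<subseteq> X \<and> P \<subseteq> Y)"

definition coset :: "'v::ab_group_add \<Rightarrow> 'v set \<Rightarrow> 'v set" where
  "coset v X = (\<lambda>x. v + x) ` X"

definition quot :: "'v::ab_group_add set \<Rightarrow> 'v set set" where
  "quot X = {coset v X | v. True}"

definition qadd :: "'v::ab_group_add set \<Rightarrow> 'v set \<Rightarrow> 'v set" where
  "qadd A B = {a + b | a b. a \<in> A \<and> b \<in> B}"

definition qsmul :: "('k::division_ring \<Rightarrow> 'v::ab_group_add \<Rightarrow> 'v) \<Rightarrow> 'v set \<Rightarrow> 'k \<Rightarrow> 'v set \<Rightarrow> 'v set" where
  "qsmul sm X a A = {sm a v + x | v x. v \<in> A \<and> x \<in> X}"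

definition iso_quot :: "('k::division_ring \<Rightarrow> 'v::ab_group_add \<Rightarrow> 'v) \<Rightarrow> 'v set \<Rightarrow> bool" where
  "iso_quot sm X \<longleftrightarrow> (\<exists>f. bij_betw f X (quot X) \<and>
      (\<forall>x\<in>X. \<forall>y\<in>X. f (x + y) = qadd (f x) (f y)) \<and>
      (\<forall>a. \<forall>x\<in>X. f (sm a x) = qsmul sm X a (f x)))"

definition Gset :: "('k::division_ring \<Rightarrow> 'v::ab_group_add \<Rightarrow> 'v) \<Rightarrow> 'v set set" where
  "Gset sm = {X. subspace sm X \<and> iso_quot sm X}"

definition distant :: "'v::ab_group_add set \<Rightarrow> 'v set \<Rightarrow> bool" where
  "distant X Y \<longleftrightarrow> {x + y | x y. x \<in> X \<and> y \<in> Y} = UNIV \<and> X \<inter> Y = {0}"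

definition R1 :: "('k::division_ring \<Rightarrow> 'v::ab_group_add \<Rightarrow> 'v) \<Rightarrow> 'v set set \<Rightarrow> bool" where
  "R1 sm Rg \<longleftrightarrow> (\<forall>X\<in>Rg. \<forall>Y\<in>Rg. X \<noteq> Y \<longrightarrow> distant X Y) \<and>
     (\<exists>A\<in>Rg. \<exists>B\<in>Rg. \<exists>C\<in>Rg. A \<noteq> B \<and> A \<noteq> C \<and> B \<noteq> C)"

definition R2 :: "('k::division_ring \<Rightarrow> 'v::ab_group_add \<Rightarrow> 'v) \<Rightarrow> 'v set set \<Rightarrow> bool" where
  "R2 sm Rg \<longleftrightarrow> (\<forall>L. is_line sm L \<longrightarrow>
     (\<forall>A\<in>Rg. \<forall>B\<in>Rg. \<forall>C\<in>Rg. A \<noteq> B \<and> A \<noteq> C \<and> B \<noteq> C \<and>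
        meets sm L A \<and> meets sm L B \<and> meets sm L C \<longrightarrow> (\<forall>X\<in>Rg. meets sm L X)))"

definition Z_regulus :: "('k::division_ring \<Rightarrow> 'v::ab_group_add \<Rightarrow> 'v) \<Rightarrow> 'v set set \<Rightarrow> bool" where
  "Z_regulus sm Rg \<longleftrightarrow> Rg \<subseteq> Gset sm \<and> R1 sm Rg \<and> R2 sm Rg \<and>
     \<not> (\<exists>Rg'. Rg \<subset> Rg' \<and> Rg' \<subseteq> Gset sm \<and> R1 sm Rg' \<and> R2 sm Rg')"

text \<open>A ring is given by carrier C, addition p, multiplication t, zero z0, one o1.
  2x2 matrices are quadruples (a,b,c,d) = [[a,b],[c,d]]; row vectors act on the left.\<close>

definition mat_mul :: "('r \<Rightarrow> 'r \<Rightarrow> 'r) \<Rightarrow> ('r \<Rightarrow> 'r \<Rightarrow> 'r) \<Rightarrow> 'r \<times> 'r \<times> 'r \<times> 'r \<Rightarrow> 'r \<times> 'r \<times> 'r \<times> 'r \<Rightarrow> 'r \<times> 'r \<times> 'r \<times> 'r" where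
  "mat_mul p t M N = (case M of (a, b, c, d) \<Rightarrow> case N of (a', b', c', d') \<Rightarrow>
     (p (t a a') (t b c'), p (t a b') (t b d'), p (t c a') (t d c'), p (t c b') (t d d')))"

definition row_act :: "('r \<Rightarrow> 'r \<Rightarrow> 'r) \<Rightarrow> ('r \<Rightarrow> 'r \<Rightarrow> 'r) \<Rightarrow> 'r \<times> 'r \<Rightarrow> 'r \<times> 'r \<times> 'r \<times> 'r \<Rightarrow> 'r \<times> 'r" where
  "row_act p t v M = (case v of (x, y) \<Rightarrow> case M of (a, b, c, d) \<Rightarrow>
     (p (t x a) (t y c), p (t x b) (t y d)))"

definition mat_in :: "'r set \<Rightarrow> 'r \<times> 'r \<times> 'r \<times> 'r \<Rightarrow> bool" where
  "mat_in C M = (case M of (a, b, c, d) \<Rightarrow> a \<in> C \<and> b \<in> C \<and> c \<in> C \<and> d \<in> C)"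

definition GL2 :: "'r set \<Rightarrow> ('r \<Rightarrow> 'r \<Rightarrow> 'r) \<Rightarrow> ('r \<Rightarrow> 'r \<Rightarrow> 'r) \<Rightarrow> 'r \<Rightarrow> 'r \<Rightarrow> ('r \<times> 'r \<times> 'r \<times> 'r) set" where
  "GL2 C p t z0 o1 = {M. mat_in C M \<and> (\<exists>N. mat_in C N \<and>
      mat_mul p t M N = (o1, z0, z0, o1) \<and> mat_mul p t N M = (o1, z0, z0, o1))}"

definition cyc :: "'r set \<Rightarrow> ('r \<Rightarrow> 'r \<Rightarrow> 'r) \<Rightarrow> 'r \<times> 'r \<Rightarrow> ('r \<times> 'r) set" where
  "cyc C t v = {(t r (fst v), t r (snd v)) | r. r \<in> C}"

definition sub_act :: "('r \<Rightarrow> 'r \<Rightarrow> 'r) \<Rightarrow> ('r \<Rightarrow> 'r \<Rightarrow> 'r) \<Rightarrow> ('r \<times> 'r) set \<Rightarrow> 'r \<times> 'r \<times> 'r \<times> 'r \<Rightarrow> ('r \<times> 'r) set" where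
  "sub_act p t S M = (\<lambda>w. row_act p t w M) ` S"

definition proj_line :: "'r set \<Rightarrow> ('r \<Rightarrow> 'r \<Rightarrow> 'r) \<Rightarrow> ('r \<Rightarrow> 'r \<Rightarrow> 'r) \<Rightarrow> 'r \<Rightarrow> 'r \<Rightarrow> ('r \<times> 'r) set set" where
  "proj_line C p t z0 o1 = {sub_act p t (cyc C t (o1, z0)) M | M. M \<in> GL2 C p t z0 o1}"

text \<open>Endomorphisms of U are represented by functions on 'v that vanish outside U.\<close>
definition EndU :: "('k::division_ring \<Rightarrow> 'v::ab_group_add \<Rightarrow> 'v) \<Rightarrow> 'v set \<Rightarrow> ('v \<Rightarrow> 'v) set" where
  "EndU sm U = {f. (\<forall>x\<in>U. \<forall>y\<in>U. f (x + y) = f x + f y) \<and> (\<forall>a. \<forall>x\<in>U. f (sm a x) = sm a (f x))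
      \<and> f ` U \<subseteq> U \<and> (\<forall>u. u \<notin> U \<longrightarrow> f u = 0)}"

definition rplus :: "('v::ab_group_add \<Rightarrow> 'v) \<Rightarrow> ('v \<Rightarrow> 'v) \<Rightarrow> 'v \<Rightarrow> 'v" where
  "rplus f g = (\<lambda>u. f u + g u)"

text \<open>Product alpha*beta means: first alpha, then beta (u^(alpha beta) = (u^alpha)^beta).\<close>
definition rtimes :: "('v \<Rightarrow> 'v) \<Rightarrow> ('v \<Rightarrow> 'v) \<Rightarrow> 'v \<Rightarrow> 'v" where
  "rtimes f g = g \<circ> f"

definition rzero :: "'v::ab_group_add \<Rightarrow> 'v" where
  "rzero = (\<lambda>u. 0)"

definition rone :: "'v::ab_group_add set \<Rightarrow> 'v \<Rightarrow> 'v" where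
  "rone U = (\<lambda>u. if u \<in> U then u else 0)"

definition centre :: "'k::division_ring set" where
  "centre = {z. \<forall>k. z * k = k * z}"

definition zid :: "('k::division_ring \<Rightarrow> 'v::ab_group_add \<Rightarrow> 'v) \<Rightarrow> 'v set \<Rightarrow> 'k \<Rightarrow> 'v \<Rightarrow> 'v" where
  "zid sm U z = (\<lambda>u. if u \<in> U then sm z u else 0)"

definition PR :: "('k::division_ring \<Rightarrow> 'v::ab_group_add \<Rightarrow> 'v) \<Rightarrow> 'v set \<Rightarrow> (('v \<Rightarrow> 'v) \<times> ('v \<Rightarrow> 'v)) set set" where
  "PR sm U = proj_line (EndU sm U) rplus rtimes rzero (rone U)"

definition PZ :: "('k::division_ring \<times> 'k) set set" where
  "PZ = proj_line centre (+) (*) 0 1"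

definition PZ_emb :: "('k::division_ring \<Rightarrow> 'v::ab_group_add \<Rightarrow> 'v) \<Rightarrow> 'v set \<Rightarrow> (('v \<Rightarrow> 'v) \<times> ('v \<Rightarrow> 'v)) set set" where
  "PZ_emb sm U = {cyc (EndU sm U) rtimes (zid sm U x, zid sm U y) | x y.
      x \<in> centre \<and> y \<in> centre \<and> cyc centre (*) (x, y) \<in> PZ}"

definition Z_chains :: "('k::division_ring \<Rightarrow> 'v::ab_group_add \<Rightarrow> 'v) \<Rightarrow> 'v set \<Rightarrow> (('v \<Rightarrow> 'v) \<times> ('v \<Rightarrow> 'v)) set set set" where
  "Z_chains sm U = {(\<lambda>S. sub_act rplus rtimes S M) ` PZ_emb sm U | M.
      M \<in> GL2 (EndU sm U) rplus rtimes rzero (rone U)}"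

definition Phi :: "('k::division_ring \<Rightarrow> 'v::ab_group_add \<Rightarrow> 'v) \<Rightarrow> 'v set \<Rightarrow> ('v \<Rightarrow> 'v) \<Rightarrow> (('v \<Rightarrow> 'v) \<times> ('v \<Rightarrow> 'v)) set \<Rightarrow> 'v set" where
  "Phi sm U lam S = (SOME X. \<exists>\<alpha> \<beta>. \<alpha> \<in> EndU sm U \<and> \<beta> \<in> EndU sm U \<and>
      S = cyc (EndU sm U) rtimes (\<alpha>, \<beta>) \<and> X = {\<alpha> u + lam (\<beta> u) | u. u \<in> U})"

end

theory Submission
  imports Defs
begin

text \<open>A splitting \<open>V = A \<oplus> h(A)\<close> with \<open>h\<close> linear and injective determines the family of the subspaces
  \<open>{x a + h (y a) | a \<in> A}\<close>, where \<open>(x, y)\<close> runs through the nonzero pairs of central scalars.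
  Any three mutually distant subspaces \<open>A, B, C\<close> have the form \<open>A, h(A), {a + h a | a \<in> A}\<close>, and a
  family with (R1) and (R2) containing them lies in the family of \<open>(A, h)\<close>: its further elements are
  graphs of linear maps of \<open>A\<close> fixing every point, that is, of central homotheties. As the family of
  \<open>(A, h)\<close> itself satisfies (R1) and (R2), the \<open>Z\<close>-reguli are exactly these families. On the other
  hand, the matrices in \<open>GL(2, R)\<close> correspond to the splittings \<open>(A, h)\<close> together with an
  isomorphism from \<open>U\<close> to \<open>A\<close>, and such an isomorphism always exists because bases of \<open>A\<close> and
  \<open>U\<close>, each giving half a basis of \<open>V\<close>, are equipotent. Under this correspondence the chain of a matrix is mapped by \<open>\<Phi>\<close> to the family of
  \<open>(A, h)\<close>.\<close>

section \<open>Linear algebra over a division ring\<close>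

text \<open>Two obstacles shape the argument. First, \<open>K\<close> need not commute. The map
  \<open>a\<close> to \<open>x a\<close> is linear when \<open>x\<close> is central, which is why
  only central coordinates occur; with them, computations inside a splitting become those with 2x2
  systems and determinants over \<open>Z\<close>. Conversely, a linear map fixing every point could
  have an eigenvalue that varies along a point: if \<open>k u = c u\<close>, then
  \<open>k (s u) = s c u\<close>. Comparison with a second, independent vector forces a single
  scalar, and linearity then makes it central. This is the use of \<open>dim V > 2\<close>: it
  provides two independent vectors in \<open>A\<close>, whereas on a one-dimensional
  \<open>A\<close> every linear map fixes the only point. Second, \<open>V\<close> may be
  infinite-dimensional, so the dimension of \<open>A\<close> is not obtained by halving a number. If
  a basis \<open>B\<close> of \<open>A\<close> is infinite, each vector of \<open>B\<close> and of
  \<open>h(B)\<close> involves finitely many vectors of another basis of \<open>V\<close>, and these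
  finite sets together must exhaust that basis. Subspaces are sets in the type of \<open>V\<close>
  and maps are total functions, constrained only on the subspace in question; the pair
  \<open>(U, lam)\<close> of the theorem is a splitting of this kind itself.\<close>

locale left_space =
  fixes sm :: "'k::division_ring \<Rightarrow> 'v::ab_group_add \<Rightarrow> 'v"
  assumes left_vs: "left_vs sm"
begin

lemma sm_add_right: "sm a (x + y) = sm a x + sm a y"
  and sm_add_left: "sm (a + b) x = sm a x + sm b x"
  and sm_sm [simp]: "sm a (sm b x) = sm (a * b) x"
  and sm_one [simp]: "sm 1 x = x"
  using left_vs unfolding left_vs_def by blast+

lemma sm_zero_left [simp]: "sm 0 x = 0"
  using sm_add_left[of 0 0 x] by simp

lemma sm_zero_right [simp]: "sm a 0 = 0"
  using sm_add_right[of a 0 0] by simp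

lemma sm_minus_left: "sm (- a) x = - sm a x"
proof -
  have "sm (- a) x + sm a x = 0"
    by (simp flip: sm_add_left)
  then show ?thesis
    by (simp add: eq_neg_iff_add_eq_0)
qed

lemma sm_minus_right: "sm a (- x) = - sm a x"
proof -
  have "sm a (- x) + sm a x = 0"
    by (simp flip: sm_add_right)
  then show ?thesis
    by (simp add: eq_neg_iff_add_eq_0)
qed

lemma sm_diff_left: "sm (a - b) x = sm a x - sm b x"
  using sm_add_left[of a "- b" x] by (simp add: sm_minus_left)

lemma sm_diff_right: "sm a (x - y) = sm a x - sm a y"
  using sm_add_right[of a x "- y"] by (simp add: sm_minus_right)

lemma sm_sum_right: "sm a (\<Sum>i\<in>I. f i) = (\<Sum>i\<in>I. sm a (f i))"
  by (induction I rule: infinite_finite_induct) (simp_all add: sm_add_right)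

lemma sm_eq_0_iff [simp]: "sm a x = 0 \<longleftrightarrow> a = 0 \<or> x = 0"
proof
  assume "sm a x = 0"
  then have "sm (inverse a) (sm a x) = 0" by simp
  then show "a = 0 \<or> x = 0" by (cases "a = 0") simp_all
qed auto

lemma subspace_0: "subspace sm X \<Longrightarrow> 0 \<in> X"
  and subspace_add: "subspace sm X \<Longrightarrow> x \<in> X \<Longrightarrow> y \<in> X \<Longrightarrow> x + y \<in> X"
  and subspace_sm: "subspace sm X \<Longrightarrow> x \<in> X \<Longrightarrow> sm a x \<in> X"
  unfolding subspace_def by blast+

lemma subspace_minus: "subspace sm X \<Longrightarrow> x \<in> X \<Longrightarrow> - x \<in> X"
  using subspace_sm[of X x "- 1"] by (simp add: sm_minus_left)

lemma subspace_diff: "subspace sm X \<Longrightarrow> x \<in> X \<Longrightarrow> y \<in> X \<Longrightarrow> x - y \<in> X"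
  using subspace_add[of X x "- y"] subspace_minus by simp

lemma subspace_sum: "subspace sm X \<Longrightarrow> (\<And>i. i \<in> I \<Longrightarrow> f i \<in> X) \<Longrightarrow> (\<Sum>i\<in>I. f i) \<in> X"
  by (induction I rule: infinite_finite_induct) (auto intro: subspace_0 subspace_add)

lemma subspace_sm_iff: "subspace sm X \<Longrightarrow> a \<noteq> 0 \<Longrightarrow> sm a x \<in> X \<longleftrightarrow> x \<in> X"
  using subspace_sm[of X "sm a x" "inverse a"] subspace_sm[of X x a] by auto

section \<open>Spans and linear combinations\<close>

lemma subspace_span: "subspace sm (span sm S)"
  unfolding span_def subspace_def by blast

lemma span_base: "x \<in> S \<Longrightarrow> x \<in> span sm S"
  unfolding span_def by blast

lemma span_minimal: "S \<subseteq> X \<Longrightarrow> subspace sm X \<Longrightarrow> span sm S \<subseteq> X"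
  unfolding span_def by blast

lemma span_mono: "S \<subseteq> T \<Longrightarrow> span sm S \<subseteq> span sm T"
  unfolding span_def by blast

lemma span_insert_cases:
  assumes "x \<in> span sm (insert b S)"
  obtains k where "x - sm k b \<in> span sm S"
proof -
  let ?X = "{x. \<exists>k. x - sm k b \<in> span sm S}"
  have "subspace sm ?X"
    unfolding subspace_def
  proof (intro conjI ballI allI)
    show "0 \<in> ?X"
      using subspace_0[OF subspace_span] by (auto intro!: exI[of _ 0])
  next
    fix x y assume "x \<in> ?X" "y \<in> ?X"
    then obtain k l where "x - sm k b \<in> span sm S" "y - sm l b \<in> span sm S" by blast
    then have "(x - sm k b) + (y - sm l b) \<in> span sm S"
      by (rule subspace_add[OF subspace_span])
    then have "(x + y) - sm (k + l) b \<in> span sm S"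
      by (simp add: sm_add_left algebra_simps)
    then show "x + y \<in> ?X" by blast
  next
    fix a x assume "x \<in> ?X"
    then obtain k where "x - sm k b \<in> span sm S" by blast
    then have "sm a (x - sm k b) \<in> span sm S" by (rule subspace_sm[OF subspace_span])
    then show "sm a x \<in> ?X" by (auto simp: sm_diff_right)
  qed
  moreover have "insert b S \<subseteq> ?X"
    using subspace_0[OF subspace_span] span_base
    by (auto intro: exI[of _ 0] exI[of _ 1])
  ultimately have "x \<in> ?X"
    by (intro subsetD[OF span_minimal assms])
  then show ?thesis
    using that by auto
qed

lemma span_exchange:
  assumes "x \<in> span sm (insert b S)" "x \<notin> span sm S"
  shows "b \<in> span sm (insert x S)"
proof -
  obtain k where k: "x - sm k b \<in> span sm S"
    using assms(1) by (rule span_insert_cases)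
  have "k \<noteq> 0"
    using k assms(2) by (intro notI) simp
  have "x - (x - sm k b) \<in> span sm (insert x S)"
    using subsetD[OF span_mono[OF subset_insertI] k]
    by (rule subspace_diff[OF subspace_span span_base[OF insertI1]])
  then show ?thesis
    using \<open>k \<noteq> 0\<close> subspace_sm_iff[OF subspace_span] by simp
qed

text \<open>The graph of the linear extension of \<open>f\<close> from \<open>B\<close> to its span, single-valued if \<open>B\<close> is
  independent.\<close>

definition comb :: "'v set \<Rightarrow> ('v \<Rightarrow> 'v) \<Rightarrow> 'v \<Rightarrow> 'v \<Rightarrow> bool" where
  "comb B f x y \<longleftrightarrow> (\<exists>F c. finite F \<and> F \<subseteq> B \<and>
     x = (\<Sum>b\<in>F. sm (c b) b) \<and> y = (\<Sum>b\<in>F. sm (c b) (f b)))"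

lemma combI: "finite F \<Longrightarrow> F \<subseteq> B \<Longrightarrow> comb B f (\<Sum>b\<in>F. sm (c b) b) (\<Sum>b\<in>F. sm (c b) (f b))"
  unfolding comb_def by (intro exI[of _ F] exI[of _ c]) simp

lemma combE:
  assumes "comb B f x y"
  obtains F c where "finite F" "F \<subseteq> B"
    "x = (\<Sum>b\<in>F. sm (c b) b)" "y = (\<Sum>b\<in>F. sm (c b) (f b))"
  using assms unfolding comb_def by (elim exE conjE) (rule that)

lemma comb_0: "comb B f 0 0"
  using combI[of "{}"] by simp

lemma comb_base: "b \<in> B \<Longrightarrow> comb B f b (f b)"
  using combI[of "{b}" B f "\<lambda>_. 1"] by simp

lemma comb_add:
  assumes "comb B f x y" "comb B f x' y'"
  shows "comb B f (x + x') (y + y')"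
proof -
  from assms(1) obtain F c where F: "finite F" "F \<subseteq> B"
    "x = (\<Sum>b\<in>F. sm (c b) b)" "y = (\<Sum>b\<in>F. sm (c b) (f b))" by (rule combE)
  from assms(2) obtain G d where G: "finite G" "G \<subseteq> B"
    "x' = (\<Sum>b\<in>G. sm (d b) b)" "y' = (\<Sum>b\<in>G. sm (d b) (f b))" by (rule combE)
  \<comment> \<open>Both coefficient families are extended by 0, so that the two sums range over
    \<open>F \<union> G\<close> and can be added termwise.\<close>
  define c' where "c' b = (if b \<in> F then c b else 0)" for b
  define d' where "d' b = (if b \<in> G then d b else 0)" for b
  have F': "(\<Sum>b\<in>F. sm (c b) (j b)) = (\<Sum>b\<in>F \<union> G. sm (c' b) (j b))" for j
    using F(1) G(1) by (intro sum.mono_neutral_cong_left) (auto simp: c'_def)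
  have G': "(\<Sum>b\<in>G. sm (d b) (j b)) = (\<Sum>b\<in>F \<union> G. sm (d' b) (j b))" for j
    using F(1) G(1) by (intro sum.mono_neutral_cong_left) (auto simp: d'_def)
  have "comb B f (\<Sum>b\<in>F \<union> G. sm (c' b + d' b) b) (\<Sum>b\<in>F \<union> G. sm (c' b + d' b) (f b))"
    using F G by (intro combI) auto
  then show ?thesis
    unfolding F(3,4) G(3,4) F' G' by (simp add: sm_add_left sum.distrib)
qed

lemma comb_sm:
  assumes "comb B f x y"
  shows "comb B f (sm a x) (sm a y)"
proof -
  from assms obtain F c where F: "finite F" "F \<subseteq> B"
    "x = (\<Sum>b\<in>F. sm (c b) b)" "y = (\<Sum>b\<in>F. sm (c b) (f b))" by (rule combE)
  from combI[OF F(1,2), of f "\<lambda>b. a * c b"] show ?thesis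
    unfolding F(3,4) by (simp add: sm_sum_right)
qed

text \<open>The first components of the relation form a subspace containing \<open>B\<close>.
  Besides totality of linear extensions, this yields the description of spans by finite linear
  combinations.\<close>

lemma comb_span:
  assumes "x \<in> span sm B"
  shows "\<exists>y. comb B f x y"
proof -
  let ?X = "{x. \<exists>y. comb B f x y}"
  have "subspace sm ?X"
    unfolding subspace_def mem_Collect_eq by (blast intro: comb_0 comb_add comb_sm)
  moreover have "B \<subseteq> ?X"
    by (blast intro: comb_base)
  ultimately have "x \<in> ?X"
    by (intro subsetD[OF span_minimal assms])
  then show ?thesis by simp
qed

lemma span_explicit:
  assumes "x \<in> span sm S"
  obtains F c where "finite F" "F \<subseteq> S" "x = (\<Sum>s\<in>F. sm (c s) s)"
  using comb_span[OF assms] that by (blast elim: combE)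

lemma sum_in_span: "F \<subseteq> S \<Longrightarrow> (\<Sum>s\<in>F. sm (c s) s) \<in> span sm S"
  by (intro subspace_sum[OF subspace_span] subspace_sm[OF subspace_span] span_base) auto

section \<open>Independence, exchange and bases\<close>

lemma lin_indepD:
  "lin_indep sm S \<Longrightarrow> finite F \<Longrightarrow> F \<subseteq> S \<Longrightarrow> (\<Sum>x\<in>F. sm (c x) x) = 0 \<Longrightarrow> x \<in> F \<Longrightarrow> c x = 0"
  unfolding lin_indep_def by blast

lemma lin_indep_subset: "lin_indep sm T \<Longrightarrow> S \<subseteq> T \<Longrightarrow> lin_indep sm S"
  unfolding lin_indep_def by blast

text \<open>Passage from coefficients to the closure operator \<open>span\<close>, the form in which
  the exchange property can be applied.\<close>

lemma lin_indep_iff_span: "lin_indep sm S \<longleftrightarrow> (\<forall>x\<in>S. x \<notin> span sm (S - {x}))"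
proof
  assume indep: "lin_indep sm S"
  show "\<forall>x\<in>S. x \<notin> span sm (S - {x})"
  proof (intro ballI notI)
    fix x assume x: "x \<in> S" "x \<in> span sm (S - {x})"
    from x(2) obtain F c where F: "finite F" "F \<subseteq> S - {x}" "x = (\<Sum>s\<in>F. sm (c s) s)"
      by (rule span_explicit)
    \<comment> \<open>The coefficient -1 at \<open>x\<close> turns the representation of
      \<open>x\<close> into a linear relation on \<open>insert x F\<close>.\<close>
    let ?c = "c(x := - 1)"
    have "(\<Sum>s\<in>F. sm (?c s) s) = (\<Sum>s\<in>F. sm (c s) s)"
      using F(2) by (intro sum.cong) auto
    then have "(\<Sum>s\<in>insert x F. sm (?c s) s) = 0"
      using F by (subst sum.insert) (auto simp: sm_minus_left)
    then have "?c x = 0"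
      using F x(1) by (intro lin_indepD[OF indep, of "insert x F"]) auto
    then show False by simp
  qed
next
  assume *: "\<forall>x\<in>S. x \<notin> span sm (S - {x})"
  show "lin_indep sm S"
    unfolding lin_indep_def
  proof (intro allI impI ballI)
    fix F c x assume F: "finite F \<and> F \<subseteq> S \<and> (\<Sum>x\<in>F. sm (c x) x) = 0" and x: "x \<in> F"
    then have "sm (c x) x + (\<Sum>s\<in>F - {x}. sm (c s) s) = 0"
      using sum.remove[of F x "\<lambda>s. sm (c s) s"] by simp
    then have "sm (c x) x = - (\<Sum>s\<in>F - {x}. sm (c s) s)"
      by (simp add: eq_neg_iff_add_eq_0)
    also have "\<dots> \<in> span sm (S - {x})"
      using F by (intro subspace_minus[OF subspace_span] sum_in_span) auto
    finally show "c x = 0"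
      using * F x subspace_sm_iff[OF subspace_span] by blast
  qed
qed

text \<open>If an old vector \<open>y\<close> depended on the others and \<open>x\<close>,
  exchanging \<open>y\<close> with \<open>x\<close> would put \<open>x\<close> into the span of
  \<open>S\<close>.\<close>

lemma lin_indep_insert:
  assumes "lin_indep sm S" "x \<notin> span sm S"
  shows "lin_indep sm (insert x S)"
  unfolding lin_indep_iff_span
proof (intro ballI notI)
  fix y assume y: "y \<in> insert x S" "y \<in> span sm (insert x S - {y})"
  have xS: "x \<notin> S" using assms(2) span_base by blast
  show False
  proof (cases "y = x")
    case True
    with y xS assms(2) show False by simp
  next
    case False
    then have eq: "insert x S - {y} = insert x (S - {y})" by auto
    have yS: "y \<in> S" using y False by auto
    have "y \<notin> span sm (S - {y})"
      using assms(1) yS unfolding lin_indep_iff_span by blast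
    then have "x \<in> span sm (insert y (S - {y}))"
      using y(2) unfolding eq by (metis span_exchange)
    with yS assms(2) show False by (simp add: insert_absorb)
  qed
qed

text \<open>One step of Steinitz exchange: \<open>S\<close> holds the vectors already exchanged, and
  the vector to be removed is sought in \<open>F\<close>. Adding the vectors of \<open>F\<close> one
  at a time, the exchange property applies at the first that brings \<open>x\<close> into the
  span.\<close>

lemma exists_exchange:
  assumes "finite F" "x \<in> span sm (S \<union> F)" "x \<notin> span sm S"
  shows "\<exists>t\<in>F. t \<in> span sm (insert x (S \<union> (F - {t})))"
  using assms
proof (induction F rule: finite_induct)
  case empty
  then show ?case by simp
next
  case (insert t F)
  show ?case
  proof (cases "x \<in> span sm (S \<union> F)")
    case True
    then obtain u where u: "u \<in> F" "u \<in> span sm (insert x (S \<union> (F - {u})))"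
      using insert by blast
    then show ?thesis
      using span_mono[of "insert x (S \<union> (F - {u}))" "insert x (S \<union> (insert t F - {u}))"] by blast
  next
    case False
    then have "t \<in> span sm (insert x (S \<union> F))"
      using insert.prems span_exchange by simp
    then show ?thesis using insert.hyps by simp
  qed
qed

lemma card_le_span:
  assumes "finite T" "finite S" "lin_indep sm S" "S \<subseteq> span sm T"
  shows "card S \<le> card T"
proof -
  \<comment> \<open>The Steinitz statement, stronger than the inequality so that induction works:
    \<open>T'\<close> consists of the generators replaced by \<open>S\<close>, and \<open>S\<close>
    with the remaining ones still generates \<open>T\<close>.\<close>
  have "\<exists>T'\<subseteq>T. card T' = card S \<and> T \<subseteq> span sm (S \<union> (T - T'))"
    using assms(2-4)
  proof (induction S rule: finite_induct)
    case empty
    then show ?case using span_base by (intro exI[of _ "{}"]) auto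
  next
    case (insert s S)
    have "lin_indep sm S" using insert.prems(1) lin_indep_subset by blast
    then obtain T' where T': "T' \<subseteq> T" "card T' = card S" "T \<subseteq> span sm (S \<union> (T - T'))"
      using insert by blast
    have "s \<notin> span sm S"
      using insert.prems(1) insert.hyps(2) unfolding lin_indep_iff_span by auto
    moreover have "s \<in> span sm (S \<union> (T - T'))"
      using insert.prems(2) span_minimal[OF T'(3) subspace_span] by blast
    ultimately obtain t where t: "t \<in> T - T'" "t \<in> span sm (insert s (S \<union> (T - T' - {t})))"
      using exists_exchange[of "T - T'" s S] assms(1) by auto
    let ?W = "insert s S \<union> (T - insert t T')"
    have eq: "insert s (S \<union> (T - T' - {t})) = ?W" by auto
    have "S \<union> (T - T') \<subseteq> span sm ?W"
      using t(2) unfolding eq by (auto intro: span_base)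
    then have "T \<subseteq> span sm ?W"
      using T'(3) span_minimal[OF _ subspace_span] by blast
    moreover have "card (insert t T') = card (insert s S)"
      using t T' insert.hyps finite_subset[OF T'(1) assms(1)] by auto
    ultimately show ?case
      using T'(1) t(1) by (intro exI[of _ "insert t T'"]) auto
  qed
  then show ?thesis
    using assms(1) by (metis card_mono)
qed

lemma finite_lin_indep:
  assumes "finite T" "lin_indep sm S" "S \<subseteq> span sm T"
  shows "finite S"
proof (rule ccontr)
  assume "infinite S"
  then obtain F where F: "finite F" "card F = Suc (card T)" "F \<subseteq> S"
    using infinite_arbitrarily_large by blast
  have "card F \<le> card T"
    using F assms by (intro card_le_span lin_indep_subset[OF assms(2)]) auto
  with F show False by simp
qed

lemma exists_basis:
  assumes "subspace sm A"
  obtains B where "lin_indep sm B" "span sm B = A"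
proof -
  let ?P = "{B. B \<subseteq> A \<and> lin_indep sm B}"
  have "\<exists>M\<in>?P. \<forall>X\<in>?P. M \<subseteq> X \<longrightarrow> X = M"
  proof (rule subset_Zorn_nonempty)
    show "?P \<noteq> {}" by (auto simp: lin_indep_def intro!: exI[of _ "{}"])
  next
    fix \<C> assume C: "\<C> \<noteq> {}" "subset.chain ?P \<C>"
    have "lin_indep sm (\<Union>\<C>)"
      unfolding lin_indep_def
    proof (intro allI impI)
      fix F c assume F: "finite F \<and> F \<subseteq> \<Union>\<C> \<and> (\<Sum>x\<in>F. sm (c x) x) = 0"
      then obtain B where "B \<in> \<C>" "F \<subseteq> B"
        \<comment> \<open>A linear relation involves finitely many vectors, and these already lie in
          one member of the chain.\<close>
        using finite_subset_Union_chain[of F \<C>] C by blast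
      moreover from this C have "lin_indep sm B" by (auto simp: subset.chain_def)
      ultimately show "\<forall>x\<in>F. c x = 0"
        using F unfolding lin_indep_def by blast
    qed
    then show "\<Union>\<C> \<in> ?P" using C by (auto simp: subset.chain_def)
  qed
  then obtain B where "B \<in> ?P" and "\<forall>X\<in>?P. B \<subseteq> X \<longrightarrow> X = B" ..
  then have B: "B \<subseteq> A" "lin_indep sm B"
    and max: "\<And>X. X \<subseteq> A \<Longrightarrow> lin_indep sm X \<Longrightarrow> B \<subseteq> X \<Longrightarrow> X = B"
    by simp_all
  have "A \<subseteq> span sm B"
  proof (rule subsetI, rule ccontr)
    fix x assume x: "x \<in> A" "x \<notin> span sm B"
    then have "insert x B = B"
      using B by (intro max lin_indep_insert) auto
    with x span_base show False by blast
  qed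
  with B show thesis
    using that span_minimal[OF B(1) assms] by blast
qed

lemma exists_finite_support:
  assumes "x \<in> span sm S"
  shows "\<exists>F. finite F \<and> F \<subseteq> S \<and> x \<in> span sm F"
proof -
  from assms obtain F c where "finite F" "F \<subseteq> S" "x = (\<Sum>s\<in>F. sm (c s) s)"
    by (rule span_explicit)
  with sum_in_span[of F F c] show ?thesis by blast
qed

end

section \<open>Linear maps on subspaces and extension from bases\<close>

definition lin_on :: "('k::division_ring \<Rightarrow> 'v::ab_group_add \<Rightarrow> 'v) \<Rightarrow> 'v set \<Rightarrow> ('v \<Rightarrow> 'v) \<Rightarrow> bool" where
  "lin_on sm A f \<longleftrightarrow>
     (\<forall>x\<in>A. \<forall>y\<in>A. f (x + y) = f x + f y) \<and> (\<forall>a. \<forall>x\<in>A. f (sm a x) = sm a (f x))"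

context left_space
begin

lemma lin_on_add: "lin_on sm A f \<Longrightarrow> x \<in> A \<Longrightarrow> y \<in> A \<Longrightarrow> f (x + y) = f x + f y"
  and lin_on_sm: "lin_on sm A f \<Longrightarrow> x \<in> A \<Longrightarrow> f (sm a x) = sm a (f x)"
  unfolding lin_on_def by blast+

lemma lin_on_0:
  assumes "lin_on sm A f" "subspace sm A"
  shows "f 0 = 0"
  using lin_on_sm[OF assms(1) subspace_0[OF assms(2)], of 0] by simp

lemma lin_on_minus:
  assumes "lin_on sm A f" "x \<in> A"
  shows "f (- x) = - f x"
  using lin_on_sm[OF assms, of "- 1"] by (simp add: sm_minus_left)

lemma lin_on_diff:
  assumes "lin_on sm A f" "subspace sm A" "x \<in> A" "y \<in> A"
  shows "f (x - y) = f x - f y"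
  using lin_on_add[OF assms(1,3) subspace_minus[OF assms(2,4)]] lin_on_minus[OF assms(1,4)] by simp

lemma lin_on_sum:
  assumes "lin_on sm A f" "subspace sm A" "\<And>i. i \<in> I \<Longrightarrow> x i \<in> A"
  shows "f (\<Sum>i\<in>I. sm (c i) (x i)) = (\<Sum>i\<in>I. sm (c i) (f (x i)))"
  using assms(3)
proof (induction I rule: infinite_finite_induct)
  case (insert i I)
  then show ?case
    using assms(1,2)
    by (simp add: lin_on_add[of A] lin_on_sm[of A] subspace_sum subspace_sm)
qed (simp_all add: lin_on_0[OF assms(1,2)])

lemma lin_on_inj_iff:
  assumes "lin_on sm A f" "subspace sm A"
  shows "inj_on f A \<longleftrightarrow> (\<forall>x\<in>A. f x = 0 \<longrightarrow> x = 0)"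
proof
  assume "inj_on f A"
  then show "\<forall>x\<in>A. f x = 0 \<longrightarrow> x = 0"
    using lin_on_0[OF assms] subspace_0[OF assms(2)] by (metis inj_onD)
next
  assume *: "\<forall>x\<in>A. f x = 0 \<longrightarrow> x = 0"
  show "inj_on f A"
  proof (rule inj_onI)
    fix x y assume "x \<in> A" "y \<in> A" "f x = f y"
    then have "x - y = 0"
      using * lin_on_diff[OF assms, of x y] subspace_diff[OF assms(2), of x y]
      by (metis right_minus_eq)
    then show "x = y" by simp
  qed
qed

lemma lin_on_image:
  assumes "lin_on sm A f" "subspace sm A"
  shows "subspace sm (f ` A)"
  unfolding subspace_def
proof (intro conjI ballI allI)
  show "0 \<in> f ` A"
    using lin_on_0[OF assms] subspace_0[OF assms(2)] by (metis imageI)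
  show "x + y \<in> f ` A" if "x \<in> f ` A" "y \<in> f ` A" for x y
    using that lin_on_add[OF assms(1)] subspace_add[OF assms(2)] by (auto simp: image_iff) metis
  show "sm a x \<in> f ` A" if "x \<in> f ` A" for a x
    using that lin_on_sm[OF assms(1)] subspace_sm[OF assms(2)] by (auto simp: image_iff) metis
qed

lemma lin_on_inv_into:
  assumes "lin_on sm A f" "subspace sm A" "inj_on f A"
  shows "lin_on sm (f ` A) (inv_into A f)"
  unfolding lin_on_def
proof (intro conjI ballI allI)
  show "inv_into A f (x + y) = inv_into A f x + inv_into A f y" if "x \<in> f ` A" "y \<in> f ` A" for x y
    using that assms
    by (auto simp: subspace_add inv_into_f_f simp flip: lin_on_add[OF assms(1)])
  show "inv_into A f (sm a x) = sm a (inv_into A f x)" if "x \<in> f ` A" for x a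
    using that assms
    by (auto simp: subspace_sm inv_into_f_f simp flip: lin_on_sm[OF assms(1)])
qed

lemma lin_on_comp: "lin_on sm A f \<Longrightarrow> lin_on sm (f ` A) g \<Longrightarrow> lin_on sm A (\<lambda>x. g (f x))"
  unfolding lin_on_def by auto

text \<open>The relation is linear, so the difference of two values of \<open>x\<close> is a value
  of 0; independence makes all its coefficients vanish.\<close>

lemma comb_unique:
  assumes "lin_indep sm B" "comb B f x y" "comb B f x z"
  shows "y = z"
proof -
  have "comb B f (x + sm (- 1) x) (y + sm (- 1) z)"
    using assms(2,3) by (intro comb_add comb_sm)
  then have "comb B f 0 (y - z)"
    by (simp add: sm_minus_left)
  then obtain F c where F: "finite F" "F \<subseteq> B"
    "0 = (\<Sum>b\<in>F. sm (c b) b)" "y - z = (\<Sum>b\<in>F. sm (c b) (f b))" by (rule combE)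
  have "c b = 0" if "b \<in> F" for b
    by (rule lin_indepD[OF assms(1) F(1,2) F(3)[symmetric] that])
  then have "y - z = 0" unfolding F(4) by simp
  then show ?thesis by simp
qed

lemma linear_extension:
  assumes "lin_indep sm B" "lin_indep sm D" "bij_betw f B D"
  obtains g where "lin_on sm (span sm B) g" "bij_betw g (span sm B) (span sm D)"
proof
  define g where "g x = (THE y. comb B f x y)" for x
  have g: "g x = y" if "comb B f x y" for x y
    unfolding g_def using that comb_unique[OF assms(1)] by blast
  have comb_g: "comb B f x (g x)" if "x \<in> span sm B" for x
    using comb_span[OF that, of f] g by auto
  show lin: "lin_on sm (span sm B) g"
    unfolding lin_on_def by (auto intro!: g comb_add comb_sm comb_g)
  have img: "f ` B = D" and inj: "inj_on f B"
    using assms(3) by (auto simp: bij_betw_def)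
  have "inj_on g (span sm B)"
    unfolding lin_on_inj_iff[OF lin subspace_span]
  proof (intro ballI impI)
    fix x assume "x \<in> span sm B" "g x = 0"
    with comb_g have "comb B f x 0" by metis
    then obtain F c where F: "finite F" "F \<subseteq> B"
      "x = (\<Sum>b\<in>F. sm (c b) b)" "0 = (\<Sum>b\<in>F. sm (c b) (f b))" by (rule combE)
    have injF: "inj_on f F" using inj F(2) by (rule inj_on_subset)
    \<comment> \<open>The relation among the images is reindexed by \<open>D\<close>, so that the
      independence of \<open>D\<close> applies to the transported coefficients.\<close>
    have "(\<Sum>d\<in>f ` F. sm (c (inv_into F f d)) d) = (\<Sum>b\<in>F. sm (c b) (f b))"
      by (simp add: sum.reindex[OF injF] injF)
    with F(4) have "(\<Sum>d\<in>f ` F. sm (c (inv_into F f d)) d) = 0" by simp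
    moreover have "f ` F \<subseteq> D" using F(2) img by blast
    ultimately have "c (inv_into F f d) = 0" if "d \<in> f ` F" for d
      using lin_indepD[OF assms(2) finite_imageI[OF F(1)], where c="\<lambda>d. c (inv_into F f d)"] that
      by blast
    then have "c b = 0" if "b \<in> F" for b
      using that injF by force
    then show "x = 0" unfolding F(3) by simp
  qed
  moreover have "g ` span sm B = span sm D"
  proof
    show "g ` span sm B \<subseteq> span sm D"
    proof
      fix y assume "y \<in> g ` span sm B"
      then obtain x where "comb B f x y" using comb_g by blast
      then obtain F c where F: "finite F" "F \<subseteq> B" "y = (\<Sum>b\<in>F. sm (c b) (f b))"
        by (rule combE)
      show "y \<in> span sm D"
        unfolding F(3) using F(2) img
        by (intro subspace_sum[OF subspace_span] subspace_sm[OF subspace_span] span_base) auto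
    qed
    have "d \<in> g ` span sm B" if "d \<in> D" for d
    proof -
      from that img obtain b where b: "b \<in> B" "d = f b" by blast
      then have "g b = d" using g[OF comb_base] by simp
      then show ?thesis using span_base[OF b(1)] by blast
    qed
    then show "span sm D \<subseteq> g ` span sm B"
      by (intro span_minimal lin_on_image[OF lin subspace_span]) blast
  qed
  ultimately show "bij_betw g (span sm B) (span sm D)"
    by (simp add: bij_betw_def)
qed

lemma lin_indep_image:
  assumes "lin_indep sm B" "lin_on sm (span sm B) f" "inj_on f (span sm B)"
  shows "lin_indep sm (f ` B)"
  unfolding lin_indep_def
proof (intro allI impI)
  fix F c assume F: "finite F \<and> F \<subseteq> f ` B \<and> (\<Sum>x\<in>F. sm (c x) x) = 0"
  then obtain G where G: "G \<subseteq> B" "finite G" "F = f ` G"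
    by (meson finite_subset_image)
  have GB: "G \<subseteq> span sm B" using G(1) span_base by blast
  have injG: "inj_on f G" using assms(3) GB by (rule inj_on_subset)
  have "f (\<Sum>b\<in>G. sm (c (f b)) b) = (\<Sum>b\<in>G. sm (c (f b)) (f b))"
    using GB by (intro lin_on_sum[OF assms(2) subspace_span]) auto
  also have "\<dots> = 0"
    using F unfolding G(3) by (simp add: sum.reindex[OF injG])
  finally have "(\<Sum>b\<in>G. sm (c (f b)) b) = 0"
    using assms(3) sum_in_span[OF G(1), of "\<lambda>b. c (f b)"] unfolding lin_on_inj_iff[OF assms(2) subspace_span] by blast
  then have "c (f b) = 0" if "b \<in> G" for b
    using lin_indepD[OF assms(1) G(2,1), where c="\<lambda>b. c (f b)"] that by blast
  then show "\<forall>x\<in>F. c x = 0" unfolding G(3) by blast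
qed

text \<open>A relation splits into a part over \<open>B\<close> and a part over \<open>D\<close>.
  Each is the negative of the other, so both lie in the trivial intersection of the spans and vanish
  separately.\<close>

lemma lin_indep_Un:
  assumes "lin_indep sm B" "lin_indep sm D" "span sm B \<inter> span sm D = {0}"
  shows "lin_indep sm (B \<union> D)"
  unfolding lin_indep_def
proof (intro allI impI)
  fix F c assume F: "finite F \<and> F \<subseteq> B \<union> D \<and> (\<Sum>x\<in>F. sm (c x) x) = 0"
  let ?x = "\<Sum>x\<in>F \<inter> B. sm (c x) x" and ?y = "\<Sum>x\<in>F - B. sm (c x) x"
  have "?x + ?y = 0"
    using F sum.Int_Diff[of F "\<lambda>x. sm (c x) x" B] by simp
  then have eq: "?x = - ?y" by (simp add: eq_neg_iff_add_eq_0)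
  have y: "?y \<in> span sm D"
    using F by (intro sum_in_span) auto
  have "?x \<in> span sm B" by (intro sum_in_span) auto
  moreover have "?x \<in> span sm D"
    unfolding eq by (rule subspace_minus[OF subspace_span y])
  ultimately have x0: "?x = 0" using assms(3) by blast
  with eq have y0: "?y = 0" by simp
  have "c x = 0" if "x \<in> F \<inter> B" for x
    using F by (intro lin_indepD[OF assms(1) _ _ x0 that]) auto
  moreover have "c x = 0" if "x \<in> F - B" for x
    using F by (intro lin_indepD[OF assms(2) _ _ y0 that]) auto
  ultimately show "\<forall>x\<in>F. c x = 0" by blast
qed

lemma lin_indep_nonzero: "lin_indep sm S \<Longrightarrow> x \<in> S \<Longrightarrow> x \<noteq> 0"
  unfolding lin_indep_iff_span using subspace_0[OF subspace_span] by blast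

end

section \<open>Splittings of the space into two isomorphic summands\<close>

text \<open>A frame identifies \<open>V\<close> with \<open>A x A\<close> through
  \<open>x + h y\<close>. One notion serves both for \<open>(U, lam)\<close>, which gives the
  coordinates of matrices, and for the pairs \<open>(A, h)\<close> attached to reguli.\<close>

definition frame :: "('k::division_ring \<Rightarrow> 'v::ab_group_add \<Rightarrow> 'v) \<Rightarrow> 'v set \<Rightarrow> ('v \<Rightarrow> 'v) \<Rightarrow> bool" where
  "frame sm A h \<longleftrightarrow> subspace sm A \<and> lin_on sm A h \<and> inj_on h A \<and> distant A (h ` A)"

context left_space
begin

lemma distant_decomp:
  assumes "distant X Y"
  obtains x y where "x \<in> X" "y \<in> Y" "v = x + y"
proof -
  have "v \<in> {x + y | x y. x \<in> X \<and> y \<in> Y}"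
    using assms by (simp add: distant_def)
  then show ?thesis using that by blast
qed

lemma distant_Int: "distant X Y \<Longrightarrow> x \<in> X \<Longrightarrow> x \<in> Y \<Longrightarrow> x = 0"
  unfolding distant_def by blast

lemma distantI:
  assumes "subspace sm X" "subspace sm Y" "\<And>x. x \<in> X \<Longrightarrow> x \<in> Y \<Longrightarrow> x = 0"
    and "\<And>v. \<exists>x\<in>X. \<exists>y\<in>Y. v = x + y"
  shows "distant X Y"
  unfolding distant_def using assms subspace_0 by fast

lemma distant_sym: "distant X Y \<Longrightarrow> distant Y X"
proof -
  have "{x + y | x y. x \<in> Y \<and> y \<in> X} = {x + y | x y. x \<in> X \<and> y \<in> Y}"
    using add.commute by blast
  then show "distant X Y \<Longrightarrow> distant Y X"
    unfolding distant_def by (simp add: Int_commute)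
qed

lemma distant_unique:
  assumes "distant X Y" "subspace sm X" "subspace sm Y"
    and "x \<in> X" "x' \<in> X" "y \<in> Y" "y' \<in> Y" "x + y = x' + y'"
  shows "x = x'" "y = y'"
proof -
  have "x - x' = y' - y" using assms(8) by (simp add: algebra_simps)
  moreover have "x - x' \<in> X" "y' - y \<in> Y" using assms subspace_diff by auto
  ultimately have "x - x' = 0" using distant_Int[OF assms(1)] by metis
  then show "x = x'" by simp
  then show "y = y'" using assms(8) by simp
qed

lemma frameD:
  assumes "frame sm A h"
  shows "subspace sm A" "lin_on sm A h" "inj_on h A" "distant A (h ` A)" "subspace sm (h ` A)"
  using assms lin_on_image unfolding frame_def by blast+

lemma frame_eq_0:
  assumes "frame sm A h" "x \<in> A" "y \<in> A" "x + h y = 0"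
  shows "x = 0" "y = 0"
proof -
  note fr = frameD[OF assms(1)]
  have "x + h y = 0 + h 0" using assms(4) lin_on_0[OF fr(2,1)] by simp
  then have "x = 0 \<and> h y = h 0"
    using distant_unique[OF fr(4,1,5), of x 0 "h y" "h 0"] assms(2,3) subspace_0[OF fr(1)] by simp
  then show "x = 0" "y = 0"
    using fr(3) assms(3) subspace_0[OF fr(1)] by (auto dest: inj_onD)
qed

lemma frame_eq:
  assumes "frame sm A h" "x \<in> A" "y \<in> A" "x' \<in> A" "y' \<in> A" "x + h y = x' + h y'"
  shows "x = x'" "y = y'"
proof -
  note fr = frameD[OF assms(1)]
  have "x = x' \<and> h y = h y'"
    using distant_unique[OF fr(4,1,5), of x x' "h y" "h y'"] assms by simp
  then show "x = x'" "y = y'"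
    using fr(3) assms by (auto dest: inj_onD)
qed

lemma frame_decomp:
  assumes "frame sm A h"
  obtains x y where "x \<in> A" "y \<in> A" "v = x + h y"
proof -
  obtain x z where "x \<in> A" "z \<in> h ` A" "v = x + z"
    using frameD(4)[OF assms] by (rule distant_decomp)
  then show ?thesis using that by blast
qed

section \<open>Half bases and the equipotence of summands\<close>

lemma frame_basis:
  assumes "frame sm A h" "lin_indep sm B" "span sm B = A"
  shows "lin_indep sm (B \<union> h ` B)" "span sm (B \<union> h ` B) = UNIV" "B \<inter> h ` B = {}"
proof -
  note fr = frameD[OF assms(1)]
  have indep: "lin_indep sm (h ` B)"
    using fr assms by (intro lin_indep_image) auto
  have "B \<subseteq> A" using span_base assms(3) by blast
  then have sub: "span sm (h ` B) \<subseteq> h ` A"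
    by (intro span_minimal fr) auto
  have "span sm B \<inter> span sm (h ` B) \<subseteq> {0}"
    using sub distant_Int[OF fr(4)] assms(3) by blast
  then have "span sm B \<inter> span sm (h ` B) = {0}"
    using subspace_0[OF subspace_span] by blast
  then show "lin_indep sm (B \<union> h ` B)"
    by (rule lin_indep_Un[OF assms(2) indep])
  show "B \<inter> h ` B = {}"
    using \<open>B \<subseteq> A\<close> distant_Int[OF fr(4)] lin_indep_nonzero[OF assms(2)] by blast
  have "h a \<in> span sm (h ` B)" if a: "a \<in> A" for a
  proof -
    from a assms(3) obtain F c where F: "finite F" "F \<subseteq> B" "a = (\<Sum>b\<in>F. sm (c b) b)"
      using span_explicit by metis
    have "h a = (\<Sum>b\<in>F. sm (c b) (h b))"
      unfolding F(3) using F(2) \<open>B \<subseteq> A\<close> by (intro lin_on_sum[OF fr(2,1)]) auto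
    then show ?thesis
      using F(2)
      by (auto intro!: subspace_sum[OF subspace_span] intro: subspace_sm[OF subspace_span] span_base)
  qed
  then have "h a \<in> span sm (B \<union> h ` B)" if "a \<in> A" for a
    using that span_mono[of "h ` B" "B \<union> h ` B"] by blast
  moreover have "A \<subseteq> span sm (B \<union> h ` B)"
    using span_mono[of B "B \<union> h ` B"] assms(3) by blast
  ultimately have "v \<in> span sm (B \<union> h ` B)" for v
    using frame_decomp[OF assms(1), of v] subspace_add[OF subspace_span] by (metis subsetD)
  then show "span sm (B \<union> h ` B) = UNIV" by blast
qed

text \<open>In the finite case, \<open>2 * card D \<le> 2 * card B\<close> by comparing bases of
  \<open>V\<close>. In the infinite case, finite supports bound the size of any basis of
  \<open>V\<close> by that of \<open>B\<close>.\<close>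

lemma frame_basis_inj:
  assumes A: "frame sm A h" "lin_indep sm B" "span sm B = A"
    and U: "frame sm U k" "lin_indep sm D" "span sm D = U"
  shows "\<exists>f. inj_on f D \<and> f ` D \<subseteq> B"
proof (cases "finite B")
  case True
  note indep = frame_basis(1)[OF U]
  have sub: "D \<union> k ` D \<subseteq> span sm (B \<union> h ` B)"
    using frame_basis(2)[OF A] by simp
  have fin: "finite (D \<union> k ` D)"
    using True by (intro finite_lin_indep[OF _ indep sub]) simp
  have cards: "card (E \<union> l ` E) = 2 * card E"
    if "finite (E \<union> l ` E)" "frame sm C l" "lin_indep sm E" "span sm E = C" for C l E
  proof -
    have "E \<subseteq> C" using that(4) span_base by blast
    then have "card (l ` E) = card E"
      using inj_on_subset[OF frameD(3)[OF that(2)]] by (intro card_image)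
    then show ?thesis
      using that(1) frame_basis(3)[OF that(2-4)] by (subst card_Un_disjoint) auto
  qed
  have "card (D \<union> k ` D) \<le> card (B \<union> h ` B)"
    using True fin by (intro card_le_span[OF _ _ indep sub]) simp
  then have "card D \<le> card B"
    using cards[OF _ A] cards[OF fin U] True by simp
  then show ?thesis
    using True fin by (simp add: inj_on_iff_card_le)
next
  case False
  let ?E = "D \<union> k ` D"
  have UNIV: "span sm ?E = UNIV" by (rule frame_basis(2)[OF U])
  have "\<exists>F. finite F \<and> F \<subseteq> ?E \<and> b \<in> span sm F \<and> h b \<in> span sm F" for b
  proof -
    obtain F G where "finite F" "F \<subseteq> ?E" "b \<in> span sm F" "finite G" "G \<subseteq> ?E" "h b \<in> span sm G"
      using exists_finite_support[of _ ?E] UNIV by (metis UNIV_I)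
    then show ?thesis
      using span_mono[of F "F \<union> G"] span_mono[of G "F \<union> G"] by (intro exI[of _ "F \<union> G"]) auto
  qed
  then obtain S where S: "\<And>b. finite (S b)" "\<And>b. S b \<subseteq> ?E" "\<And>b. b \<in> span sm (S b)"
    "\<And>b. h b \<in> span sm (S b)" by metis
  let ?W = "\<Union>b\<in>B. S b"
  have "B \<union> h ` B \<subseteq> span sm ?W"
  proof -
    have "span sm (S b) \<subseteq> span sm ?W" if "b \<in> B" for b
      using that by (intro span_mono) blast
    with S(3,4) show ?thesis by blast
  qed
  then have W: "span sm ?W = UNIV"
    using span_minimal[OF _ subspace_span] frame_basis(2)[OF A] by blast
  \<comment> \<open>The supports generate \<open>V\<close>; a basis vector outside them would lie in
    the span of the other basis vectors.\<close>
  have "?E \<subseteq> ?W"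
  proof (rule subsetI, rule ccontr)
    fix x assume x: "x \<in> ?E" "x \<notin> ?W"
    then have "?W \<subseteq> ?E - {x}" using S(2) by blast
    from span_mono[OF this] W x(1) frame_basis(1)[OF U] show False
      unfolding lin_indep_iff_span by blast
  qed
  \<comment> \<open>\<open>?W\<close> is a union of finite sets indexed by the infinite set
    \<open>B\<close>, hence no larger than \<open>B\<close>.\<close>
  moreover have "(card_of ?W, card_of B) \<in> ordLeq"
  proof -
    have "(card_of (S b), card_of B) \<in> ordLeq" for b
      using ordLeq_total[OF card_of_Well_order card_of_Well_order] card_of_ordLeq_finite False S(1)
      by blast
    then show ?thesis
      using False by (intro card_of_UNION_ordLeq_infinite) (auto intro: card_of_mono1)
  qed
  ultimately have "(card_of D, card_of B) \<in> ordLeq"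
    by (meson card_of_mono1 ordLeq_transitive Un_upper1 subset_trans)
  then show ?thesis
    by (simp flip: card_of_ordLeq)
qed

text \<open>The injection between half bases exists in both directions, so Schroeder-Bernstein gives
  a bijection of bases, which extends linearly.\<close>

lemma frames_iso:
  assumes "frame sm U k" "frame sm A h"
  obtains g where "lin_on sm U g" "bij_betw g U A"
proof -
  obtain D where D: "lin_indep sm D" "span sm D = U"
    using exists_basis frameD(1)[OF assms(1)] by blast
  obtain B where B: "lin_indep sm B" "span sm B = A"
    using exists_basis frameD(1)[OF assms(2)] by blast
  obtain f where "bij_betw f D B"
    using frame_basis_inj[OF assms(1) D assms(2) B] frame_basis_inj[OF assms(2) B assms(1) D]
      Schroeder_Bernstein by metis
  then show thesis
    using linear_extension[OF D(1) B(1), of f] that unfolding D B by blast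
qed

text \<open>If \<open>A\<close> consisted of multiples of \<open>u\<close>, the two vectors
  \<open>u\<close> and \<open>h u\<close> would generate \<open>V\<close>. The case
  \<open>u = 0\<close> is included; it supplies a nonzero vector of \<open>A\<close>.\<close>

lemma frame_two_dim:
  assumes "dim_gt2 sm" "frame sm A h" "u \<in> A"
  obtains v where "v \<in> A" "\<And>s. v \<noteq> sm s u"
proof -
  note fr = frameD[OF assms(2)]
  have "\<exists>v\<in>A. \<forall>s. v \<noteq> sm s u"
  proof (rule ccontr)
    assume "\<not> ?thesis"
    then have *: "\<exists>s. v = sm s u" if "v \<in> A" for v using that by blast
    have "v \<in> span sm {u, h u}" for v
    proof -
      obtain x y where xy: "x \<in> A" "y \<in> A" "v = x + h y"
        using frame_decomp[OF assms(2)] by blast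
      from * xy obtain s t where "x = sm s u" "y = sm t u" by metis
      then have "v = sm s u + sm t (h u)"
        using xy lin_on_sm[OF fr(2) assms(3)] by simp
      then show ?thesis
        by (simp add: subspace_add[OF subspace_span] subspace_sm[OF subspace_span] span_base)
    qed
    moreover from assms(1) obtain S where S: "finite S" "card S = 3" "lin_indep sm S"
      unfolding dim_gt2_def by blast
    ultimately have "card S \<le> card {u, h u}"
      by (intro card_le_span) auto
    also have "\<dots> \<le> 2" by (simp add: card_insert_if)
    finally show False using S by simp
  qed
  with that show thesis by blast
qed

end

section \<open>Reguli in a splitting\<close>

context left_space
begin

lemma centre_comm: "z \<in> centre \<Longrightarrow> z * k = k * z"
  unfolding centre_def by blast

lemma centre_0 [simp]: "0 \<in> centre" and centre_1 [simp]: "1 \<in> centre"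
  by (simp_all add: centre_def)

lemma centre_minus: "z \<in> centre \<Longrightarrow> - z \<in> centre"
  by (simp add: centre_def)

lemma centre_diff: "z \<in> centre \<Longrightarrow> w \<in> centre \<Longrightarrow> z - w \<in> centre"
  by (simp add: centre_def algebra_simps)

lemma centre_mult:
  fixes z w :: 'k
  assumes "z \<in> centre" "w \<in> centre"
  shows "z * w \<in> centre"
proof -
  have "z * w * k = k * (z * w)" for k
    using centre_comm[OF assms(1)] centre_comm[OF assms(2)] by (metis mult.assoc)
  then show ?thesis by (simp add: centre_def)
qed

lemma centre_inverse:
  fixes z :: 'k
  assumes "z \<in> centre"
  shows "inverse z \<in> centre"
proof (cases "z = 0")
  case False
  have "inverse z * k = k * inverse z" for k
  proof -
    have "inverse z * k = inverse z * (k * z) * inverse z"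
      using False by (simp add: mult.assoc)
    also have "\<dots> = inverse z * (z * k) * inverse z"
      by (simp only: centre_comm[OF assms])
    also have "\<dots> = k * inverse z"
      using False by (simp flip: mult.assoc)
    finally show ?thesis .
  qed
  then show ?thesis by (simp add: centre_def)
qed simp

lemma sm_centre: "z \<in> centre \<Longrightarrow> sm z (sm a x) = sm a (sm z x)"
  by (simp add: centre_comm)

text \<open>The scalar \<open>y\<close> stands inside \<open>h\<close> so that both frame
  coordinates of the vector, \<open>sm x a\<close> and \<open>sm y a\<close>, are visible as
  elements of \<open>A\<close>.\<close>

definition pt :: "('v \<Rightarrow> 'v) \<Rightarrow> 'k \<Rightarrow> 'k \<Rightarrow> 'v \<Rightarrow> 'v" where
  "pt h x y a = sm x a + h (sm y a)"

text \<open>The element of the regulus of \<open>(A, h)\<close> with homogeneous coordinates \<open>(x : y)\<close> is \<open>rg A h x y\<close>.\<close>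

definition rg :: "'v set \<Rightarrow> ('v \<Rightarrow> 'v) \<Rightarrow> 'k \<Rightarrow> 'k \<Rightarrow> 'v set" where
  "rg A h x y = pt h x y ` A"

definition reg :: "'v set \<Rightarrow> ('v \<Rightarrow> 'v) \<Rightarrow> 'v set set" where
  "reg A h = {rg A h x y | x y. x \<in> centre \<and> y \<in> centre \<and> (x \<noteq> 0 \<or> y \<noteq> 0)}"

lemma regE:
  assumes "X \<in> reg A h"
  obtains x y where "x \<in> centre" "y \<in> centre" "x \<noteq> 0 \<or> y \<noteq> 0" "X = rg A h x y"
  using assms unfolding reg_def by blast

lemma regI: "x \<in> centre \<Longrightarrow> y \<in> centre \<Longrightarrow> x \<noteq> 0 \<or> y \<noteq> 0 \<Longrightarrow> rg A h x y \<in> reg A h"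
  unfolding reg_def by blast

text \<open>A complement \<open>Y\<close> of \<open>X\<close> is a set of representatives for
  \<open>V/X\<close>, so \<open>f\<close> followed by taking cosets is an isomorphism from
  \<open>X\<close> to \<open>V/X\<close>.\<close>

lemma GsetI:
  assumes "subspace sm X" "subspace sm Y" "distant X Y" "lin_on sm X f" "bij_betw f X Y"
  shows "X \<in> Gset sm"
proof -
  let ?f = "\<lambda>x. coset (f x) X"
  have coset_iff: "w \<in> coset v X \<longleftrightarrow> w - v \<in> X" for v w
    unfolding coset_def image_iff by (metis add_diff_cancel_left' diff_add_cancel add.commute)
  have coset_eq: "coset v X = coset w X \<longleftrightarrow> v - w \<in> X" for v w
  proof
    assume "coset v X = coset w X"
    moreover have "v \<in> coset v X" by (simp add: coset_iff subspace_0[OF assms(1)])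
    ultimately show "v - w \<in> X" by (simp add: coset_iff)
  next
    assume *: "v - w \<in> X"
    have "u - v \<in> X \<longleftrightarrow> u - w \<in> X" for u
      using subspace_add[OF assms(1) _ *, of "u - v"] subspace_diff[OF assms(1) _ *, of "u - w"]
      by auto
    then show "coset v X = coset w X" by (auto simp: coset_iff)
  qed
  have img: "f ` X = Y" and inj: "inj_on f X"
    using assms(5) by (auto simp: bij_betw_def)
  have "inj_on ?f X"
  proof (rule inj_onI)
    fix x x' assume x: "x \<in> X" "x' \<in> X" "?f x = ?f x'"
    then have "f x - f x' \<in> X" by (simp add: coset_eq)
    moreover have "f x - f x' \<in> Y" using x img subspace_diff[OF assms(2)] by blast
    ultimately have "f x - f x' = 0" by (rule distant_Int[OF assms(3)])
    then have "f x = f x'" by simp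
    then show "x = x'" using inj x by (auto dest: inj_onD)
  qed
  moreover have "?f ` X = quot X"
  proof
    show "?f ` X \<subseteq> quot X" unfolding quot_def by blast
    show "quot X \<subseteq> ?f ` X"
    proof
      fix Q assume "Q \<in> quot X"
      then obtain v where v: "Q = coset v X" unfolding quot_def by blast
      obtain x y where xy: "x \<in> X" "y \<in> Y" "v = x + y"
        using assms(3) by (rule distant_decomp)
      then have "Q = coset y X" using v by (simp add: coset_eq)
      with xy img show "Q \<in> ?f ` X" by blast
    qed
  qed
  ultimately have bij: "bij_betw ?f X (quot X)" by (simp add: bij_betw_def)
  have add: "?f (x + y) = qadd (?f x) (?f y)" if "x \<in> X" "y \<in> X" for x y
  proof (rule set_eqI)
    fix w
    have "w \<in> qadd (?f x) (?f y) \<longleftrightarrow> (\<exists>a b. w = a + b \<and> a - f x \<in> X \<and> b - f y \<in> X)"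
      unfolding qadd_def by (auto simp: coset_iff)
    also have "\<dots> \<longleftrightarrow> w - (f x + f y) \<in> X"
    proof
      assume "\<exists>a b. w = a + b \<and> a - f x \<in> X \<and> b - f y \<in> X"
      then obtain a b where ab: "w = a + b" "a - f x \<in> X" "b - f y \<in> X" by blast
      from subspace_add[OF assms(1) ab(2,3)] ab(1) show "w - (f x + f y) \<in> X"
        by (simp add: algebra_simps)
    next
      assume "w - (f x + f y) \<in> X"
      then show "\<exists>a b. w = a + b \<and> a - f x \<in> X \<and> b - f y \<in> X"
        using subspace_0[OF assms(1)]
        by (intro exI[of _ "f x"] exI[of _ "w - f x"]) (simp add: algebra_simps)
    qed
    finally show "w \<in> ?f (x + y) \<longleftrightarrow> w \<in> qadd (?f x) (?f y)"
      using lin_on_add[OF assms(4) that] by (simp add: coset_iff)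
  qed
  have smul: "?f (sm a x) = qsmul sm X a (?f x)" if "x \<in> X" for a x
  proof (rule set_eqI)
    fix w
    have "w \<in> qsmul sm X a (?f x) \<longleftrightarrow> (\<exists>v z. w = sm a v + z \<and> v - f x \<in> X \<and> z \<in> X)"
      unfolding qsmul_def by (auto simp: coset_iff)
    also have "\<dots> \<longleftrightarrow> w - sm a (f x) \<in> X"
    proof
      assume "\<exists>v z. w = sm a v + z \<and> v - f x \<in> X \<and> z \<in> X"
      then obtain v z where vz: "w = sm a v + z" "v - f x \<in> X" "z \<in> X" by blast
      from subspace_add[OF assms(1) subspace_sm[OF assms(1) vz(2), of a] vz(3)] vz(1)
      show "w - sm a (f x) \<in> X" by (simp add: sm_diff_right algebra_simps)
    next
      assume "w - sm a (f x) \<in> X"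
      then show "\<exists>v z. w = sm a v + z \<and> v - f x \<in> X \<and> z \<in> X"
        using subspace_0[OF assms(1)]
        \<comment> \<open>The remainder is put into the summand from \<open>X\<close> and not
          divided by \<open>a\<close>, so the witness also covers \<open>a = 0\<close>.\<close>
        by (intro exI[of _ "f x"] exI[of _ "w - sm a (f x)"]) simp
    qed
    finally show "w \<in> ?f (sm a x) \<longleftrightarrow> w \<in> qsmul sm X a (?f x)"
      using lin_on_sm[OF assms(4) that] by (simp add: coset_iff)
  qed
  show ?thesis
    unfolding Gset_def iso_quot_def using assms(1) bij add smul by (intro CollectI conjI exI[of _ ?f]) auto
qed

lemma pt_add: "lin_on sm A h \<Longrightarrow> subspace sm A \<Longrightarrow> a \<in> A \<Longrightarrow> b \<in> A \<Longrightarrow>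
    pt h x y (a + b) = pt h x y a + pt h x y b"
  unfolding pt_def by (simp add: sm_add_right lin_on_add[of A] subspace_sm algebra_simps)

text \<open>Centrality of the coordinates enters here: \<open>x s = s x\<close> and
  \<open>y s = s y\<close> allow \<open>s\<close> to be moved to the front.\<close>

lemma pt_sm:
  assumes "lin_on sm A h" "subspace sm A" "a \<in> A" "x \<in> centre" "y \<in> centre"
  shows "pt h x y (sm s a) = sm s (pt h x y a)"
  unfolding pt_def using assms
  by (simp add: sm_add_right centre_comm flip: lin_on_sm[OF assms(1)] add: subspace_sm)

lemma pt_lin: "lin_on sm A h \<Longrightarrow> subspace sm A \<Longrightarrow> x \<in> centre \<Longrightarrow> y \<in> centre \<Longrightarrow> lin_on sm A (pt h x y)"
  unfolding lin_on_def[of sm A "pt h x y"] by (simp add: pt_add pt_sm)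

lemma pt_eq_0:
  assumes "frame sm A h" "x \<noteq> 0 \<or> y \<noteq> 0" "a \<in> A" "pt h x y a = 0"
  shows "a = 0"
  using frame_eq_0[OF assms(1), of "sm x a" "sm y a"] assms frameD(1)[OF assms(1)]
  by (auto simp: pt_def subspace_sm)

lemma pt_inj:
  assumes "frame sm A h" "x \<in> centre" "y \<in> centre" "x \<noteq> 0 \<or> y \<noteq> 0"
  shows "inj_on (pt h x y) A"
  using pt_eq_0[OF assms(1,4)] frameD[OF assms(1)] assms(2,3)
  by (simp add: lin_on_inj_iff[OF pt_lin])

lemma rg_subspace:
  "frame sm A h \<Longrightarrow> x \<in> centre \<Longrightarrow> y \<in> centre \<Longrightarrow> subspace sm (rg A h x y)"
  unfolding rg_def by (intro lin_on_image pt_lin frameD)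

text \<open>Trivial intersection and generation of \<open>V\<close> amount to unique solvability of
  a 2x2 system whose determinant \<open>?D\<close> is central and nonzero.\<close>

lemma rg_distant:
  assumes fr: "frame sm A h"
    and cen: "x \<in> centre" "y \<in> centre" "x' \<in> centre" "y' \<in> centre"
    and det: "x * y' \<noteq> y * x'"
  shows "distant (rg A h x y) (rg A h x' y')"
proof (rule distantI)
  note A = frameD(1)[OF fr] and h = frameD(2)[OF fr]
  note comm = centre_comm[OF cen(1)] centre_comm[OF cen(2)] centre_comm[OF cen(3)]
  let ?D = "x * y' - y * x'"
  have D: "?D \<in> centre" "?D \<noteq> 0"
    using cen det by (auto intro: centre_diff centre_mult)
  show "subspace sm (rg A h x y)" "subspace sm (rg A h x' y')"
    using fr cen by (auto intro: rg_subspace)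
  show "v = 0" if v: "v \<in> rg A h x y" "v \<in> rg A h x' y'" for v
  proof -
    from v obtain a a' where a: "a \<in> A" "a' \<in> A" "v = pt h x y a" "v = pt h x' y' a'"
      unfolding rg_def by blast
    then have "sm x a = sm x' a'" "sm y a = sm y' a'"
      using frame_eq[OF fr, of "sm x a" "sm y a" "sm x' a'" "sm y' a'"] subspace_sm[OF A]
      by (simp_all add: pt_def)
    \<comment> \<open>Multiplication by \<open>y'\<close> and \<open>x'\<close> makes the right-hand
      sides equal, as these scalars commute; subtraction eliminates \<open>a'\<close> and leaves
      \<open>?D\<close>.\<close>
    then have "sm y' (sm x a) = sm y' (sm x' a')" "sm x' (sm y a) = sm x' (sm y' a')"
      by simp_all
    then have "sm ?D a = 0"
      by (simp add: sm_diff_left comm(1)[of y'] comm(2)[of x'] comm(3)[of y'])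
    then have "a = 0" using D by simp
    then show "v = 0" using a lin_on_0[OF h A] by (simp add: pt_def)
  qed
  show "\<exists>r\<in>rg A h x y. \<exists>s\<in>rg A h x' y'. v = r + s" for v
  proof -
    \<comment> \<open>Division by the determinant is done in advance on \<open>v\<close>; the
      vectors \<open>?a\<close> and \<open>?a'\<close> below are then the numerators of Cramer's
      rule.\<close>
    obtain p q where pq: "p \<in> A" "q \<in> A" "sm (inverse ?D) v = p + h q"
      using frame_decomp[OF fr] by blast
    let ?a = "sm y' p - sm x' q" and ?a' = "sm x q - sm y p"
    have aA: "?a \<in> A" "?a' \<in> A"
      using pq by (auto intro!: subspace_diff[OF A] subspace_sm[OF A])
    have 1: "sm x ?a + sm x' ?a' = sm ?D p"
      by (simp add: sm_diff_right sm_diff_left comm(2)[of x'] comm(1)[of x'])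
    have 2: "sm y ?a + sm y' ?a' = sm ?D q"
      by (simp add: sm_diff_right sm_diff_left comm(1)[of y'] comm(2)[of y'])
    have "pt h x y ?a + pt h x' y' ?a' = (sm x ?a + sm x' ?a') + h (sm y ?a + sm y' ?a')"
      using aA unfolding pt_def by (simp add: lin_on_add[OF h] subspace_sm[OF A] algebra_simps)
    also have "\<dots> = sm ?D (p + h q)"
      unfolding 1 2 using pq by (simp add: sm_add_right lin_on_sm[OF h])
    also have "\<dots> = v"
      using D(2) unfolding pq(3)[symmetric] by simp
    finally show ?thesis
      unfolding rg_def using aA by (metis imageI)
  qed
qed

text \<open>A vanishing determinant makes \<open>(x', y')\<close> a multiple of the nonzero pair
  \<open>(x, y)\<close>. The factor \<open>z\<close> stands on the right, so it acts on
  \<open>a\<close> first and only changes the parameter within \<open>A\<close>.\<close>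

lemma rg_subset:
  fixes x y x' y' :: 'k
  assumes fr: "frame sm A h"
    and cen: "x \<in> centre" "y \<in> centre" "x' \<in> centre" "y' \<in> centre"
    and nz: "x \<noteq> 0 \<or> y \<noteq> 0" and det: "x * y' = y * x'"
  shows "rg A h x' y' \<subseteq> rg A h x y"
proof -
  have "\<exists>z. x' = x * z \<and> y' = y * z"
  proof (cases "x = 0")
    case True
    with nz det have "y \<noteq> 0" "x' = 0" by auto
    with True show ?thesis by (intro exI[of _ "inverse y * y'"]) (simp flip: mult.assoc)
  next
    case False
    have "y * (inverse x * x') = inverse x * (y * x')"
      using centre_comm[OF cen(2), of "inverse x"] by (simp flip: mult.assoc)
    also have "\<dots> = y'"
      using False by (simp flip: det mult.assoc)
    finally show ?thesis
      using False by (intro exI[of _ "inverse x * x'"]) (simp flip: mult.assoc)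
  qed
  then obtain z where z: "x' = x * z" "y' = y * z" by blast
  have "pt h x' y' a = pt h x y (sm z a)" for a
    by (simp add: pt_def z)
  then show ?thesis
    unfolding rg_def using subspace_sm[OF frameD(1)[OF fr]] by blast
qed

lemma rg_eq:
  assumes "frame sm A h" "x \<in> centre" "y \<in> centre" "x' \<in> centre" "y' \<in> centre"
    and "x \<noteq> 0 \<or> y \<noteq> 0" "x' \<noteq> 0 \<or> y' \<noteq> 0" "x * y' = y * x'"
  shows "rg A h x y = rg A h x' y'"
proof
  show "rg A h x' y' \<subseteq> rg A h x y" using assms by (intro rg_subset)
  show "rg A h x y \<subseteq> rg A h x' y'"
    using assms centre_comm[of x' y] centre_comm[of y' x] by (intro rg_subset) auto
qed

lemma reg_distant:
  assumes "frame sm A h" "X \<in> reg A h" "Y \<in> reg A h" "X \<noteq> Y"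
  shows "distant X Y"
  using assms rg_eq[OF assms(1)] rg_distant[OF assms(1)] by (elim regE) metis

text \<open>A second member of the family serves as complement, and the two parametrisations by
  \<open>A\<close> give the isomorphism between them.\<close>

lemma reg_subset_Gset:
  assumes fr: "frame sm A h"
  shows "reg A h \<subseteq> Gset sm"
proof
  fix X assume "X \<in> reg A h"
  then obtain x y where xy: "x \<in> centre" "y \<in> centre" "x \<noteq> 0 \<or> y \<noteq> 0" "X = rg A h x y"
    by (rule regE)
  \<comment> \<open>One of the pairs (1, 0) and (0, 1) always has nonzero determinant with
    \<open>(x, y)\<close>.\<close>
  obtain x' y' :: 'k where xy': "x' \<in> centre" "y' \<in> centre" "x * y' \<noteq> y * x'"
  proof (cases "x = 0")
    case True
    with xy(3) show ?thesis by (intro that[of 1 0]) auto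
  next
    case False
    then show ?thesis by (intro that[of 0 1]) auto
  qed
  then have nz': "x' \<noteq> 0 \<or> y' \<noteq> 0" by auto
  let ?g = "inv_into A (pt h x y)"
  note lin = pt_lin[OF frameD(2,1)[OF fr]]
  note inj = pt_inj[OF fr xy(1-3)]
  have g: "lin_on sm X ?g" "?g ` X = A" "inj_on ?g X"
    unfolding xy(4) rg_def using xy inj frameD(1)[OF fr]
    by (auto intro: lin_on_inv_into lin inj_on_inv_into)
  have "bij_betw ?g X A" "bij_betw (pt h x' y') A (rg A h x' y')"
    using g(2,3) pt_inj[OF fr xy'(1,2) nz'] by (simp_all add: bij_betw_def rg_def)
  from bij_betw_trans[OF this] have "bij_betw (\<lambda>v. pt h x' y' (?g v)) X (rg A h x' y')"
    by (simp add: comp_def)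
  moreover have "lin_on sm X (\<lambda>v. pt h x' y' (?g v))"
    using lin_on_comp[OF g(1), of "pt h x' y'"] xy' by (simp add: g(2) lin)
  ultimately show "X \<in> Gset sm"
    using xy xy' fr by (intro GsetI[of X "rg A h x' y'"]) (simp_all add: rg_subspace rg_distant)
qed

lemma frame_nonzero:
  assumes "dim_gt2 sm" "frame sm A h"
  obtains a where "a \<in> A" "a \<noteq> 0"
  using frame_two_dim[OF assms subspace_0[OF frameD(1)[OF assms(2)]]] by (metis sm_zero_right)

lemma rg_neq:
  assumes "dim_gt2 sm" "frame sm A h"
    and "x \<in> centre" "y \<in> centre" "x' \<in> centre" "y' \<in> centre"
    and "x * y' \<noteq> y * x'"
  shows "rg A h x y \<noteq> rg A h x' y'"
proof
  assume eq: "rg A h x y = rg A h x' y'"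
  obtain a where a: "a \<in> A" "a \<noteq> 0" using frame_nonzero[OF assms(1,2)] .
  have "x \<noteq> 0 \<or> y \<noteq> 0" using assms(7) by auto
  have "pt h x y a \<in> rg A h x y" using a by (simp add: rg_def)
  then have "pt h x y a = 0"
    using distant_Int[OF rg_distant[OF assms(2-7)]] eq by blast
  then show False using pt_eq_0[OF assms(2) \<open>x \<noteq> 0 \<or> y \<noteq> 0\<close>] a by blast
qed

text \<open>The coordinates 0 and 1 are central, so the points (1:0), (0:1), (1:1) are available
  however small the centre is.\<close>

lemma reg_R1:
  assumes "dim_gt2 sm" "frame sm A h"
  shows "R1 sm (reg A h)"
  unfolding R1_def
proof (intro conjI ballI impI)
  show "distant X Y" if "X \<in> reg A h" "Y \<in> reg A h" "X \<noteq> Y" for X Y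
    using that by (rule reg_distant[OF assms(2)])
  show "\<exists>X\<in>reg A h. \<exists>Y\<in>reg A h. \<exists>W\<in>reg A h. X \<noteq> Y \<and> X \<noteq> W \<and> Y \<noteq> W"
    by (intro bexI[of _ "rg A h 1 0"] bexI[of _ "rg A h 0 1"] bexI[of _ "rg A h 1 1"]
        conjI rg_neq assms regI) simp_all
qed

section \<open>Points, lines and transversals\<close>

lemma span_empty: "span sm {} = {0}"
proof
  show "span sm {} \<subseteq> {0}"
    by (rule span_minimal) (auto simp: subspace_def)
qed (simp add: subspace_0[OF subspace_span])

lemma lin_indep_singleton: "u \<noteq> 0 \<Longrightarrow> lin_indep sm {u}"
  unfolding lin_indep_iff_span by (simp add: span_empty)

lemma in_span_singleton:
  assumes "v \<in> span sm {u}"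
  obtains k where "v = sm k u"
proof -
  from assms obtain k where "v - sm k u \<in> span sm {}" by (rule span_insert_cases)
  with that show ?thesis by (simp add: span_empty)
qed

lemma in_span_pair:
  assumes "r \<in> span sm {p, q}"
  obtains s t where "r = sm s p + sm t q"
proof -
  from assms obtain s where "r - sm s p \<in> span sm {q}" by (rule span_insert_cases)
  then obtain t where "r - sm s p = sm t q" by (rule in_span_singleton)
  with that show ?thesis by (simp add: algebra_simps)
qed

lemma lin_indep_pair:
  assumes "u \<noteq> 0" "\<And>s. v \<noteq> sm s u"
  shows "lin_indep sm {u, v}"
proof -
  have "v \<notin> span sm {u}" using assms(2) in_span_singleton by metis
  with lin_indep_singleton[OF assms(1)] have "lin_indep sm (insert v {u})"
    by (rule lin_indep_insert)
  then show ?thesis by (simp add: insert_commute)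
qed

lemma meets_iff:
  assumes "subspace sm X" "subspace sm Y"
  shows "meets sm X Y \<longleftrightarrow> (\<exists>r. r \<noteq> 0 \<and> r \<in> X \<and> r \<in> Y)"
proof
  assume "meets sm X Y"
  then obtain P S where P: "P \<subseteq> X" "P \<subseteq> Y" "card S = 1" "lin_indep sm S" "P = span sm S"
    unfolding meets_def is_point_def by blast
  then obtain s where "S = {s}" by (auto simp: card_1_singleton_iff)
  with P lin_indep_nonzero span_base show "\<exists>r. r \<noteq> 0 \<and> r \<in> X \<and> r \<in> Y" by blast
next
  assume "\<exists>r. r \<noteq> 0 \<and> r \<in> X \<and> r \<in> Y"
  then obtain r where r: "r \<noteq> 0" "r \<in> X" "r \<in> Y" by blast
  then have "is_point sm (span sm {r})"
    unfolding is_point_def by (intro exI[of _ "{r}"]) (simp add: lin_indep_singleton)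
  with r assms span_minimal[of "{r}"] show "meets sm X Y"
    unfolding meets_def by auto
qed

lemma lineI: "u \<noteq> 0 \<Longrightarrow> (\<And>s. v \<noteq> sm s u) \<Longrightarrow> is_line sm (span sm {u, v})"
  unfolding is_line_def using lin_indep_pair[of u v]
  by (intro exI[of _ "{u, v}"]) (metis card_2_iff finite.intros sm_one)

lemma line_subspace: "is_line sm L \<Longrightarrow> subspace sm L"
  unfolding is_line_def using subspace_span by blast

text \<open>Otherwise \<open>r\<close>, \<open>p\<close>, \<open>q\<close> would be three
  independent vectors in a space generated by two.\<close>

lemma line_combination:
  assumes "is_line sm L" "p \<in> L" "q \<in> L" "r \<in> L" "p \<noteq> 0" "\<And>s. q \<noteq> sm s p"
  obtains s t where "r = sm s p + sm t q"
proof -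
  obtain S where S: "finite S" "card S = 2" "L = span sm S"
    using assms(1) unfolding is_line_def by blast
  have "r \<in> span sm {p, q}"
  proof (rule ccontr)
    assume r: "r \<notin> span sm {p, q}"
    then have "lin_indep sm {r, p, q}"
      using lin_indep_pair[OF assms(5,6)] by (rule lin_indep_insert[rotated])
    then have "card {r, p, q} \<le> card S"
      using S assms(2-4) by (intro card_le_span) auto
    moreover have "r \<noteq> p" "r \<noteq> q" using r span_base by blast+
    moreover have "p \<noteq> q" using assms(6)[of 1] by auto
    ultimately show False using S(2) by simp
  qed
  then show ?thesis using that by (rule in_span_pair)
qed

text \<open>The three intersection vectors are linearly related. Comparing frame coordinates in this
  relation shows that their parameters in \<open>A\<close> are proportional, so the line contains
  two different combinations of one \<open>u\<close> and \<open>h u\<close>, hence both of these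
  vectors.\<close>

lemma reg_transversal:
  assumes fr: "frame sm A h"
    and reg: "X1 \<in> reg A h" "X2 \<in> reg A h" "X3 \<in> reg A h" "X1 \<noteq> X2" "X1 \<noteq> X3" "X2 \<noteq> X3"
    and L: "is_line sm L" "meets sm L X1" "meets sm L X2" "meets sm L X3"
  obtains u where "u \<in> A" "u \<noteq> 0" "u \<in> L" "h u \<in> L"
proof -
  note A = frameD(1)[OF fr] and h = frameD(2)[OF fr]
  from reg(1) obtain x1 y1 where X1: "x1 \<in> centre" "y1 \<in> centre" "x1 \<noteq> 0 \<or> y1 \<noteq> 0"
    "X1 = rg A h x1 y1" by (rule regE)
  from reg(2) obtain x2 y2 where X2: "x2 \<in> centre" "y2 \<in> centre" "x2 \<noteq> 0 \<or> y2 \<noteq> 0"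
    "X2 = rg A h x2 y2" by (rule regE)
  from reg(3) obtain x3 y3 where X3: "x3 \<in> centre" "y3 \<in> centre" "x3 \<noteq> 0 \<or> y3 \<noteq> 0"
    "X3 = rg A h x3 y3" by (rule regE)
  have sub: "subspace sm X1" "subspace sm X2" "subspace sm X3"
    unfolding X1(4) X2(4) X3(4) by (rule rg_subspace[OF fr] X1 X2 X3)+
  note Ls = line_subspace[OF L(1)]
  obtain p q r where pqr: "p \<noteq> 0" "p \<in> L" "p \<in> X1" "q \<noteq> 0" "q \<in> L" "q \<in> X2"
    "r \<noteq> 0" "r \<in> L" "r \<in> X3"
    using L(2-4) unfolding meets_iff[OF Ls sub(1)] meets_iff[OF Ls sub(2)] meets_iff[OF Ls sub(3)]
    by blast
  have "q \<noteq> sm s p" for s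
    using pqr subspace_sm[OF sub(1) pqr(3)] distant_Int[OF reg_distant[OF fr reg(1,2,4)]] by blast
  then obtain s t where r: "r = sm s p + sm t q"
    using line_combination[OF L(1) pqr(2,5,8,1)] by blast
  \<comment> \<open>If \<open>s = 0\<close>, then \<open>r\<close> would be a nonzero vector common
    to \<open>X2\<close> and \<open>X3\<close>.\<close>
  have s: "s \<noteq> 0"
  proof
    assume "s = 0"
    then have "r \<in> X2" using r pqr(6) subspace_sm[OF sub(2)] by simp
    then show False
      using pqr distant_Int[OF reg_distant[OF fr reg(2,3,6)]] by blast
  qed
  obtain u' v' w where uvw: "u' \<in> A" "p = pt h x1 y1 u'" "v' \<in> A" "q = pt h x2 y2 v'"
    "w \<in> A" "r = pt h x3 y3 w"
    using pqr(3,6,9) unfolding X1(4) X2(4) X3(4) rg_def by blast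
  \<comment> \<open>The possibly noncentral scalars \<open>s\<close>, \<open>t\<close> are absorbed
    into the parameters; only central coefficients remain in the coordinate equations.\<close>
  define u v where "u = sm s u'" and "v = sm t v'"
  have uA: "u \<in> A" "v \<in> A" using uvw subspace_sm[OF A] by (auto simp: u_def v_def)
  have "u' \<noteq> 0" using uvw(2) pqr(1) lin_on_0[OF h A] by (auto simp: pt_def)
  then have u0: "u \<noteq> 0" using s by (simp add: u_def)
  have pu: "sm s p = pt h x1 y1 u" and qv: "sm t q = pt h x2 y2 v"
    unfolding uvw u_def v_def using pt_sm[OF h A] uvw X1 X2 by simp_all
  have "(sm x1 u + sm x2 v) + h (sm y1 u + sm y2 v) = pt h x1 y1 u + pt h x2 y2 v"
    using uA unfolding pt_def by (simp add: lin_on_add[OF h] subspace_sm[OF A] algebra_simps)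
  also have "\<dots> = sm x3 w + h (sm y3 w)"
    using r uvw(6) pu qv by (simp add: pt_def)
  finally have "sm x1 u + sm x2 v = sm x3 w" "sm y1 u + sm y2 v = sm y3 w"
    using frame_eq[OF fr, of "sm x1 u + sm x2 v" "sm y1 u + sm y2 v" "sm x3 w" "sm y3 w"]
      uA uvw(5) by (auto intro: subspace_sm[OF A] subspace_add[OF A])
  \<comment> \<open>Multiplying by \<open>y3\<close> and \<open>x3\<close> eliminates
    \<open>w\<close>. The resulting relation between \<open>u\<close> and \<open>v\<close> has as
    coefficients the determinants of the pairs \<open>X1, X3\<close> and
    \<open>X2, X3\<close>.\<close>
  then have "sm y3 (sm x1 u + sm x2 v) = sm y3 (sm x3 w)" "sm x3 (sm y1 u + sm y2 v) = sm x3 (sm y3 w)"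
    by simp_all
  then have "sm y3 (sm x1 u + sm x2 v) = sm x3 (sm y1 u + sm y2 v)"
    using sm_centre[OF X3(1)] by metis
  then have elim: "sm (x3 * y2 - y3 * x2) v = sm (y3 * x1 - x3 * y1) u"
    by (simp add: sm_add_right sm_diff_left algebra_simps)
  let ?d = "y3 * x1 - x3 * y1" and ?e = "x3 * y2 - y3 * x2"
  have d: "?d \<noteq> 0"
    using rg_eq[OF fr X3(1,2) X1(1,2) X3(3) X1(3)] reg(5) X1(4) X3(4) by auto
  have e: "?e \<noteq> 0"
    using rg_eq[OF fr X3(1,2) X2(1,2) X3(3) X2(3)] reg(6) X2(4) X3(4) by auto
  have dc: "?d \<in> centre" "?e \<in> centre"
    using X1 X2 X3 by (auto intro: centre_diff centre_mult)
  have "sm ?e (sm t q) = pt h x2 y2 (sm ?e v)"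
    using qv pt_sm[OF h A uA(2) X2(1,2)] by simp
  also have "\<dots> = sm ?d (pt h x2 y2 u)"
    unfolding elim using pt_sm[OF h A uA(1) X2(1,2)] by simp
  finally have "sm ?d (pt h x2 y2 u) \<in> L"
    using subspace_sm[OF Ls] pqr(5) by metis
  then have P2: "pt h x2 y2 u \<in> L" using d subspace_sm_iff[OF Ls] by blast
  have P1: "pt h x1 y1 u \<in> L"
    using pu subspace_sm[OF Ls pqr(2)] by metis
  \<comment> \<open>The vectors \<open>pt h x1 y1 u\<close> and \<open>pt h x2 y2 u\<close> both lie
    in \<open>L\<close>; this nonzero determinant allows the system to be solved for
    \<open>u\<close> and \<open>h u\<close> within \<open>L\<close>.\<close>
  let ?D = "x1 * y2 - y1 * x2"
  have D: "?D \<noteq> 0"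
    using rg_eq[OF fr X1(1,2) X2(1,2) X1(3) X2(3)] reg(4) X1(4) X2(4) by auto
  have hsm: "h (sm a u) = sm a (h u)" for a
    by (rule lin_on_sm[OF h uA(1)])
  have "sm y2 (pt h x1 y1 u) - sm y1 (pt h x2 y2 u) = sm ?D u"
    unfolding pt_def hsm
    by (simp add: sm_add_right sm_diff_left centre_comm[OF X1(1), of y2] centre_comm[OF X1(2), of y2])
  then have "sm ?D u \<in> L"
    using subspace_diff[OF Ls subspace_sm[OF Ls P1] subspace_sm[OF Ls P2]] by metis
  then have uL: "u \<in> L" using D subspace_sm_iff[OF Ls] by blast
  have "sm x1 (pt h x2 y2 u) - sm x2 (pt h x1 y1 u) = sm ?D (h u)"
    unfolding pt_def hsm
    by (simp add: sm_add_right sm_diff_left centre_comm[OF X1(1), of x2] centre_comm[OF X1(2), of x2])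
  then have "sm ?D (h u) \<in> L"
    using subspace_diff[OF Ls subspace_sm[OF Ls P2] subspace_sm[OF Ls P1]] by metis
  then have "h u \<in> L" using D subspace_sm_iff[OF Ls] by blast
  with uL uA(1) u0 that show ?thesis by blast
qed

text \<open>A line containing \<open>u\<close> and \<open>h u\<close> also contains
  \<open>pt h x y u\<close>, a nonzero vector of the member with coordinates
  \<open>(x : y)\<close>.\<close>

lemma reg_R2:
  assumes fr: "frame sm A h"
  shows "R2 sm (reg A h)"
  unfolding R2_def
proof (intro allI impI ballI, elim conjE)
  fix L X1 X2 X3 X
  assume L: "is_line sm L" "meets sm L X1" "meets sm L X2" "meets sm L X3"
    and reg: "X1 \<in> reg A h" "X2 \<in> reg A h" "X3 \<in> reg A h" "X1 \<noteq> X2" "X1 \<noteq> X3" "X2 \<noteq> X3"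
    and X: "X \<in> reg A h"
  obtain u where u: "u \<in> A" "u \<noteq> 0" "u \<in> L" "h u \<in> L"
    using fr reg L by (rule reg_transversal)
  from X obtain x y where xy: "x \<in> centre" "y \<in> centre" "x \<noteq> 0 \<or> y \<noteq> 0" "X = rg A h x y"
    by (rule regE)
  note Ls = line_subspace[OF L(1)]
  have "pt h x y u \<in> L"
    unfolding pt_def lin_on_sm[OF frameD(2)[OF fr] u(1)]
    using u by (intro subspace_add[OF Ls] subspace_sm[OF Ls])
  moreover have "pt h x y u \<noteq> 0" using pt_eq_0[OF fr xy(3)] u by blast
  moreover have "pt h x y u \<in> X" using u(1) xy(4) by (simp add: rg_def)
  ultimately show "meets sm L X"
    using meets_iff[OF Ls rg_subspace[OF fr xy(1,2)]] xy(4) by blast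
qed


text \<open>Independent vectors \<open>u\<close>, \<open>w\<close> share their scalar, as seen from
  the image of \<open>u + w\<close>. Multiples of \<open>u\<close> are not covered by this
  comparison and are reached through a vector \<open>v\<close> independent of
  \<open>u\<close>.\<close>

lemma scalar_of_eigenvectors:
  assumes dim: "dim_gt2 sm" and fr: "frame sm A h" and k: "lin_on sm A k"
    and eigen: "\<And>a. a \<in> A \<Longrightarrow> \<exists>c. k a = sm c a"
  obtains z where "z \<in> centre" "\<And>a. a \<in> A \<Longrightarrow> k a = sm z a"
proof -
  note A = frameD(1)[OF fr]
  have same: "k w = sm z w"
    if prem: "u \<in> A" "w \<in> A" "u \<noteq> 0" "\<And>s. w \<noteq> sm s u" "k u = sm z u" for u w z
  proof -
    obtain c d where c: "k w = sm c w" and d: "k (u + w) = sm d (u + w)"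
      using eigen[OF prem(2)] eigen[OF subspace_add[OF A prem(1,2)]] by blast
    have "sm z u + sm c w = sm d u + sm d w"
      using d lin_on_add[OF k prem(1,2)] prem(5) c by (simp add: sm_add_right)
    then have eq: "sm (z - d) u = sm (d - c) w"
      by (simp add: sm_diff_left algebra_simps)
    have "d = c"
    proof (rule ccontr)
      assume "d \<noteq> c"
      then have "w = sm (inverse (d - c)) (sm (d - c) w)" by simp
      also have "\<dots> = sm (inverse (d - c) * (z - d)) u" unfolding eq[symmetric] by simp
      finally show False using prem(4) by blast
    qed
    with eq prem(3) show ?thesis by (simp add: c)
  qed
  obtain u where u: "u \<in> A" "u \<noteq> 0" using frame_nonzero[OF dim fr] .
  obtain v where v: "v \<in> A" "\<And>s. v \<noteq> sm s u" using frame_two_dim[OF dim fr u(1)] by metis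
  from u obtain z where z: "k u = sm z u" using eigen by blast
  have vz: "k v = sm z v" by (rule same[OF u(1) v(1) u(2) v(2) z])
  have v0: "v \<noteq> 0" using v(2)[of 0] by simp
  have all: "k w = sm z w" if w: "w \<in> A" for w
  proof (cases "\<exists>s. w = sm s u")
    case False
    then show ?thesis using same[OF u(1) w u(2) _ z] by blast
  next
    case True
    then obtain s where s: "w = sm s u" by blast
    have "w \<noteq> sm t v" if "w \<noteq> 0" for t
    proof
      assume t: "w = sm t v"
      with that have "t \<noteq> 0" by auto
      then have "v = sm (inverse t) w" unfolding t by simp
      then show False using v(2) s by simp
    qed
    then show ?thesis
      using same[OF v(1) w v0 _ vz] lin_on_0[OF k A] by (cases "w = 0") auto
  qed
  \<comment> \<open>The vector \<open>k (s u)\<close> is \<open>z s u\<close> by the common scalar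
    and \<open>s z u\<close> by linearity.\<close>
  have "z * s = s * z" for s
  proof -
    have "sm z (sm s u) = sm s (sm z u)"
      using all[OF subspace_sm[OF A u(1)]] lin_on_sm[OF k u(1)] z by simp
    then have "sm (z * s - s * z) u = 0" by (simp add: sm_diff_left)
    then show ?thesis using u(2) by simp
  qed
  then have "z \<in> centre" by (simp add: centre_def)
  with all that show thesis by blast
qed

lemma rg_1_0:
  assumes "frame sm A h"
  shows "rg A h 1 0 = A"
  using lin_on_0[OF frameD(2,1)[OF assms]] by (simp add: rg_def pt_def)

lemma rg_0_1: "rg A h 0 1 = h ` A"
  by (simp add: rg_def pt_def)

text \<open>For \<open>0 \<noteq> a \<in> A\<close> the line through \<open>a\<close> and \<open>h a\<close> is a transversal of the three given
  elements, hence it meets \<open>X\<close>. So \<open>X\<close> is the graph of a map all of whose vectors are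
  eigenvectors.\<close>

lemma R2_subset_reg:
  assumes dim: "dim_gt2 sm" and fr: "frame sm A h"
    and Rg: "R1 sm Rg" "R2 sm Rg" "rg A h 1 0 \<in> Rg" "rg A h 0 1 \<in> Rg" "rg A h 1 1 \<in> Rg"
    and X: "X \<in> Rg" "subspace sm X"
  shows "X \<in> reg A h"
\<comment> \<open>The member (0:1) is the only one that is not a graph over \<open>A\<close>; every
  other one has coordinates \<open>(1 : z)\<close>.\<close>
proof (cases "X = h ` A")
  case True
  then show ?thesis
    using regI[of 0 1 A h] by (simp add: rg_0_1)
next
  case False
  note A = frameD(1)[OF fr] and h = frameD(2)[OF fr] and hA = frameD(5)[OF fr]
  have dist: "distant X (h ` A)"
    using Rg(1,4) X(1) False by (simp add: R1_def rg_0_1)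
  \<comment> \<open>Since \<open>X\<close> is a complement of \<open>h(A)\<close>, it contains
    exactly one vector with first coordinate \<open>a\<close>; \<open>k a\<close> is its second
    coordinate.\<close>
  have ex: "\<exists>b\<in>A. a + h b \<in> X" if "a \<in> A" for a
  proof -
    obtain x y where "x \<in> X" "y \<in> h ` A" "a = x + y"
      using dist by (rule distant_decomp)
    then obtain b where xb: "x \<in> X" "b \<in> A" "a = x + h b" by blast
    then have "a + h (- b) = x" by (simp add: lin_on_minus[OF h])
    with xb subspace_minus[OF A] show ?thesis by metis
  qed
  have uniq: "b = c" if "a \<in> A" "b \<in> A" "c \<in> A" "a + h b \<in> X" "a + h c \<in> X" for a b c
  proof -
    have "h (b - c) = (a + h b) - (a + h c)"
      using that lin_on_diff[OF h A] by simp
    then have "h (b - c) \<in> X" using that subspace_diff[OF X(2)] by metis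
    moreover have bc: "b - c \<in> A" using that subspace_diff[OF A] by blast
    ultimately have "h (b - c) = 0" using distant_Int[OF dist] by blast
    then show ?thesis using frame_eq_0(2)[OF fr subspace_0[OF A] bc] by simp
  qed
  obtain k where k: "\<And>a. a \<in> A \<Longrightarrow> k a \<in> A" "\<And>a. a \<in> A \<Longrightarrow> a + h (k a) \<in> X"
    using ex by metis
  have lin: "lin_on sm A k"
    unfolding lin_on_def
  proof (intro conjI ballI allI)
    fix a b assume ab: "a \<in> A" "b \<in> A"
    have "(a + b) + h (k a + k b) = (a + h (k a)) + (b + h (k b))"
      using k ab by (simp add: lin_on_add[OF h])
    then have "(a + b) + h (k a + k b) \<in> X"
      using k ab subspace_add[OF X(2)] by metis
    then show "k (a + b) = k a + k b"
      using k ab subspace_add[OF A] by (intro uniq[of "a + b"]) auto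
  next
    fix s a assume a: "a \<in> A"
    have "sm s a + h (sm s (k a)) = sm s (a + h (k a))"
      using k a by (simp add: lin_on_sm[OF h] sm_add_right)
    then have "sm s a + h (sm s (k a)) \<in> X"
      using k a subspace_sm[OF X(2)] by metis
    then show "k (sm s a) = sm s (k a)"
      using k a subspace_sm[OF A] by (intro uniq[of "sm s a"]) auto
  qed
  have eigen: "\<exists>c. k a = sm c a" if a: "a \<in> A" for a
  proof (cases "a = 0")
    case True
    then show ?thesis using lin_on_0[OF lin A] by simp
  next
    case False
    let ?L = "span sm {a, h a}"
    have ha: "h a \<noteq> 0"
      using frame_eq_0(2)[OF fr subspace_0[OF A] a] False by auto
    have "h a \<noteq> sm s a" for s
      using ha distant_Int[OF frameD(4)[OF fr] subspace_sm[OF A a, of s]] a by (metis imageI)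
    then have line: "is_line sm ?L" by (rule lineI[OF False])
    have L: "a \<in> ?L" "h a \<in> ?L" "a + h a \<in> ?L"
      using subspace_add[OF subspace_span] by (simp_all add: span_base)
    have meet: "meets sm ?L (rg A h x y)" if "x \<in> centre" "y \<in> centre" "x \<noteq> 0 \<or> y \<noteq> 0"
        "pt h x y a \<in> ?L" for x y
    proof -
      have "pt h x y a \<noteq> 0" using pt_eq_0[OF fr that(3) a] False by blast
      then show ?thesis
        using meets_iff[OF subspace_span rg_subspace[OF fr that(1,2)]] that(4) a
        unfolding rg_def by blast
    qed
    have "meets sm ?L (rg A h 1 0)" "meets sm ?L (rg A h 0 1)" "meets sm ?L (rg A h 1 1)"
      using L lin_on_0[OF h A] by (auto intro!: meet simp: pt_def)
    moreover have "rg A h 1 0 \<noteq> rg A h 0 1" "rg A h 1 0 \<noteq> rg A h 1 1" "rg A h 0 1 \<noteq> rg A h 1 1"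
      by (simp_all add: rg_neq[OF dim fr])
    ultimately have "meets sm ?L X"
      using Rg(2-5) X(1) line unfolding R2_def by blast
    then obtain r where r: "r \<noteq> 0" "r \<in> ?L" "r \<in> X"
      using meets_iff[OF subspace_span X(2)] by blast
    obtain s t where st: "r = sm s a + sm t (h a)" using r(2) by (rule in_span_pair)
    have "s \<noteq> 0"
    proof
      assume "s = 0"
      then have "r \<in> h ` A" using st a subspace_sm[OF hA, of "h a" t] by simp
      then show False using r distant_Int[OF dist] by blast
    qed
    \<comment> \<open>Scaling the common vector to first coordinate \<open>a\<close> makes its
      second coordinate the value \<open>k a\<close>.\<close>
    then have "sm (inverse s) r = a + h (sm (inverse s * t) a)"
      unfolding st by (simp add: sm_add_right lin_on_sm[OF h a])
    then have "a + h (sm (inverse s * t) a) \<in> X"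
      using subspace_sm[OF X(2) r(3)] by metis
    then have "k a = sm (inverse s * t) a"
      using k a subspace_sm[OF A a] by (intro uniq[of a]) auto
    then show ?thesis by blast
  qed
  obtain z where z: "z \<in> centre" "\<And>a. a \<in> A \<Longrightarrow> k a = sm z a"
    using scalar_of_eigenvectors[OF dim fr lin eigen] by blast
  have "X = rg A h 1 z"
  proof
    show "rg A h 1 z \<subseteq> X"
      using k(2) z(2) by (auto simp: rg_def pt_def)
    show "X \<subseteq> rg A h 1 z"
    proof
      fix x assume x: "x \<in> X"
      obtain a b where ab: "a \<in> A" "b \<in> A" "x = a + h b" using frame_decomp[OF fr] by blast
      then have "b = k a" using x k by (intro uniq[of a]) auto
      with ab z show "x \<in> rg A h 1 z" by (auto simp: rg_def pt_def)
    qed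
  qed
  then show ?thesis using z(1) by (auto intro: regI)
qed

text \<open>For maximality: a larger family with (R1) and (R2) still contains (1:0), (0:1), (1:1),
  which confines it to \<open>reg A h\<close>.\<close>

lemma Z_regulus_reg:
  assumes dim: "dim_gt2 sm" and fr: "frame sm A h"
  shows "Z_regulus sm (reg A h)"
  unfolding Z_regulus_def
proof (intro conjI notI)
  show "reg A h \<subseteq> Gset sm" "R1 sm (reg A h)" "R2 sm (reg A h)"
    using reg_subset_Gset[OF fr] reg_R1[OF dim fr] reg_R2[OF fr] .
next
  assume "\<exists>Rg'. reg A h \<subset> Rg' \<and> Rg' \<subseteq> Gset sm \<and> R1 sm Rg' \<and> R2 sm Rg'"
  then obtain Rg' where Rg': "reg A h \<subset> Rg'" "Rg' \<subseteq> Gset sm" "R1 sm Rg'" "R2 sm Rg'" by blast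
  have "rg A h 1 0 \<in> reg A h" "rg A h 0 1 \<in> reg A h" "rg A h 1 1 \<in> reg A h"
    by (auto intro: regI)
  then have "X \<in> reg A h" if "X \<in> Rg'" for X
    using R2_subset_reg[OF dim fr Rg'(3,4) _ _ _ that] Rg'(1,2) that by (auto simp: Gset_def)
  with Rg'(1) show False by blast
qed

text \<open>As a complement of both \<open>A\<close> and \<open>B\<close>, the subspace
  \<open>C\<close> is the graph of an isomorphism from \<open>A\<close> onto \<open>B\<close>:
  injective because \<open>A\<close> and \<open>C\<close> meet trivially, surjective because they
  generate \<open>V\<close>.\<close>

lemma frame_of_triple:
  assumes A: "subspace sm A" and B: "subspace sm B" and C: "subspace sm C"
    and AB: "distant A B" and AC: "distant A C" and BC: "distant B C"
  obtains h where "frame sm A h" "h ` A = B" "rg A h 1 1 = C"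
proof -
  \<comment> \<open>The value sought is the negative of the \<open>B\<close>-component of
    \<open>a\<close> in \<open>V = C + B\<close>. It exists for every vector of \<open>V\<close>, so
    \<open>h\<close> is a total function.\<close>
  have ex: "\<exists>b\<in>B. a + b \<in> C" for a
  proof -
    obtain c b where cb: "c \<in> C" "b \<in> B" "a = c + b"
      using distant_sym[OF BC] by (rule distant_decomp)
    then have "a + (- b) = c" by simp
    with cb subspace_minus[OF B] show ?thesis by metis
  qed
  have uniq: "b = b'" if "b \<in> B" "b' \<in> B" "a + b \<in> C" "a + b' \<in> C" for a b b'
  proof -
    have "b - b' \<in> C" using subspace_diff[OF C that(3,4)] by simp
    then have "b - b' = 0" using distant_Int[OF BC subspace_diff[OF B that(1,2)]] by blast
    then show ?thesis by simp
  qed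
  obtain h where h: "\<And>a. h a \<in> B" "\<And>a. a + h a \<in> C" using ex by metis
  have lin: "lin_on sm A h"
    unfolding lin_on_def
  proof (intro conjI ballI allI)
    fix a b
    have "(a + b) + (h a + h b) = (a + h a) + (b + h b)" by simp
    then have "(a + b) + (h a + h b) \<in> C" using h(2) subspace_add[OF C] by metis
    then show "h (a + b) = h a + h b"
      using h subspace_add[OF B] by (intro uniq[of _ _ "a + b"]) auto
  next
    fix s a
    have "sm s a + sm s (h a) = sm s (a + h a)" by (simp add: sm_add_right)
    then have "sm s a + sm s (h a) \<in> C" using h(2) subspace_sm[OF C] by metis
    then show "h (sm s a) = sm s (h a)"
      using h subspace_sm[OF B] by (intro uniq[of _ _ "sm s a"]) auto
  qed
  have inj: "inj_on h A"
    unfolding lin_on_inj_iff[OF lin A]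
  proof (intro ballI impI)
    fix a assume "a \<in> A" "h a = 0"
    then show "a = 0" using h(2)[of a] distant_Int[OF AC] by simp
  qed
  have img: "h ` A = B"
  proof
    show "B \<subseteq> h ` A"
    proof
      fix b assume b: "b \<in> B"
      obtain a c where ac: "a \<in> A" "c \<in> C" "b = a + c" using AC by (rule distant_decomp)
      then have "h (- a) = b"
        using b h(1) h(2)[of "- a"] by (intro uniq[of _ _ "- a"]) auto
      then show "b \<in> h ` A" using subspace_minus[OF A ac(1)] by blast
    qed
  qed (use h in blast)
  have fr: "frame sm A h" unfolding frame_def using A lin inj AB img by simp
  have "rg A h 1 1 = C"
  proof
    show "rg A h 1 1 \<subseteq> C" using h(2) by (auto simp: rg_def pt_def)
    show "C \<subseteq> rg A h 1 1"
    proof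
      fix c assume c: "c \<in> C"
      obtain a b where ab: "a \<in> A" "b \<in> B" "c = a + b" using AB by (rule distant_decomp)
      then have "h a = b" using h c by (intro uniq[of _ _ a]) auto
      with ab show "c \<in> rg A h 1 1" by (auto simp: rg_def pt_def)
    qed
  qed
  with fr img that show thesis by blast
qed

text \<open>Any three members provide the frame; the regulus lies in its family, and maximality
  turns inclusion into equality.\<close>

lemma Z_regulus_iff:
  assumes dim: "dim_gt2 sm"
  shows "Z_regulus sm Rg \<longleftrightarrow> (\<exists>A h. frame sm A h \<and> Rg = reg A h)"
proof
  assume Rg: "Z_regulus sm Rg"
  then have R: "Rg \<subseteq> Gset sm" "R1 sm Rg" "R2 sm Rg"
    and max: "\<And>Rg'. Rg \<subseteq> Rg' \<Longrightarrow> Rg' \<subseteq> Gset sm \<Longrightarrow> R1 sm Rg' \<Longrightarrow> R2 sm Rg' \<Longrightarrow> Rg = Rg'"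
    unfolding Z_regulus_def by blast+
  from R(2) obtain A B C where ABC: "A \<in> Rg" "B \<in> Rg" "C \<in> Rg" "A \<noteq> B" "A \<noteq> C" "B \<noteq> C"
    unfolding R1_def by blast
  then have dist: "distant A B" "distant A C" "distant B C"
    using R(2) unfolding R1_def by blast+
  have sub: "subspace sm X" if "X \<in> Rg" for X
    using R(1) that by (auto simp: Gset_def)
  obtain h where h: "frame sm A h" "h ` A = B" "rg A h 1 1 = C"
    using frame_of_triple[OF sub[OF ABC(1)] sub[OF ABC(2)] sub[OF ABC(3)] dist] .
  have "X \<in> reg A h" if "X \<in> Rg" for X
    using ABC h that
    by (intro R2_subset_reg[OF dim h(1) R(2,3)]) (simp_all add: rg_1_0 rg_0_1 sub)
  then have "Rg = reg A h"
    using reg_subset_Gset[OF h(1)] reg_R1[OF dim h(1)] reg_R2[OF h(1)] by (intro max) auto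
  with h(1) show "\<exists>A h. frame sm A h \<and> Rg = reg A h" by blast
next
  show "\<exists>A h. frame sm A h \<and> Rg = reg A h \<Longrightarrow> Z_regulus sm Rg"
    using Z_regulus_reg[OF dim] by blast
qed

end

section \<open>Chains\<close>

context left_space
begin

section \<open>The endomorphism ring of U and the map Phi\<close>

lemma EndU_iff: "f \<in> EndU sm U \<longleftrightarrow> lin_on sm U f \<and> f ` U \<subseteq> U \<and> (\<forall>u. u \<notin> U \<longrightarrow> f u = 0)"
  unfolding EndU_def lin_on_def by blast

lemma EndU_lin: "f \<in> EndU sm U \<Longrightarrow> lin_on sm U f"
  and EndU_in: "f \<in> EndU sm U \<Longrightarrow> u \<in> U \<Longrightarrow> f u \<in> U"
  and EndU_out: "f \<in> EndU sm U \<Longrightarrow> u \<notin> U \<Longrightarrow> f u = 0"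
  unfolding EndU_iff by blast+

lemma EndU_add: "f \<in> EndU sm U \<Longrightarrow> u \<in> U \<Longrightarrow> v \<in> U \<Longrightarrow> f (u + v) = f u + f v"
  by (rule lin_on_add[OF EndU_lin])

lemma EndU_sm: "f \<in> EndU sm U \<Longrightarrow> u \<in> U \<Longrightarrow> f (sm s u) = sm s (f u)"
  by (rule lin_on_sm[OF EndU_lin])

lemma EndU_0: "f \<in> EndU sm U \<Longrightarrow> subspace sm U \<Longrightarrow> f 0 = 0"
  by (rule lin_on_0[OF EndU_lin])

lemma EndU_rtimes:
  assumes "subspace sm U" "f \<in> EndU sm U" "g \<in> EndU sm U"
  shows "rtimes f g \<in> EndU sm U"
proof -
  have "lin_on sm (f ` U) g"
    using EndU_lin[OF assms(3)] EndU_in[OF assms(2)] by (auto simp: lin_on_def)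
  then have "lin_on sm U (\<lambda>u. g (f u))"
    by (rule lin_on_comp[OF EndU_lin[OF assms(2)]])
  then show ?thesis
    using assms by (auto simp: EndU_iff[of _ U] rtimes_def comp_def EndU_0[OF assms(3,1)])
qed

lemma EndU_rplus:
  assumes "subspace sm U" "f \<in> EndU sm U" "g \<in> EndU sm U"
  shows "rplus f g \<in> EndU sm U"
  using EndU_add[OF assms(2)] EndU_add[OF assms(3)] EndU_sm[OF assms(2)] EndU_sm[OF assms(3)]
    EndU_out[OF assms(2)] EndU_out[OF assms(3)] EndU_in[OF assms(2)] EndU_in[OF assms(3)]
  unfolding rplus_def EndU_iff[of "\<lambda>u. f u + g u"] lin_on_def
  by (auto simp: sm_add_right algebra_simps intro: subspace_add[OF assms(1)])

lemma rone_EndU: "subspace sm U \<Longrightarrow> rone U \<in> EndU sm U"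
  by (auto simp: EndU_iff lin_on_def rone_def subspace_add subspace_sm)

lemma zid_EndU: "subspace sm U \<Longrightarrow> z \<in> centre \<Longrightarrow> zid sm U z \<in> EndU sm U"
  by (auto simp: EndU_iff lin_on_def zid_def subspace_add subspace_sm sm_add_right centre_comm)

lemma cyc_self:
  assumes "subspace sm U" "\<alpha> \<in> EndU sm U" "\<beta> \<in> EndU sm U"
  shows "(\<alpha>, \<beta>) \<in> cyc (EndU sm U) rtimes (\<alpha>, \<beta>)"
proof -
  have "rtimes (rone U) f = f" if "f \<in> EndU sm U" for f
    using EndU_out[OF that] EndU_0[OF that assms(1)] by (auto simp: rtimes_def rone_def)
  then show ?thesis
    unfolding cyc_def using rone_EndU[OF assms(1)] assms(2,3)
    by (intro CollectI exI[of _ "rone U"]) simp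
qed

lemma cyc_image_subset:
  assumes "(\<gamma>, \<delta>) \<in> cyc (EndU sm U) rtimes (\<alpha>, \<beta>)"
  shows "{\<gamma> u + lam (\<delta> u) | u. u \<in> U} \<subseteq> {\<alpha> u + lam (\<beta> u) | u. u \<in> U}"
proof -
  from assms obtain r where "r \<in> EndU sm U" "\<gamma> = \<alpha> \<circ> r" "\<delta> = \<beta> \<circ> r"
    unfolding cyc_def rtimes_def by auto
  then show ?thesis by (auto dest: EndU_in)
qed

text \<open>Well-definedness of the choice in \<open>Phi\<close>. A left factor is applied first and
  so merely restricts the parameter \<open>u\<close> to its image; generators of the same cyclic
  submodule are left multiples of each other and give the same set.\<close>

lemma Phi_cyc:
  assumes "subspace sm U" "\<alpha> \<in> EndU sm U" "\<beta> \<in> EndU sm U"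
  shows "Phi sm U lam (cyc (EndU sm U) rtimes (\<alpha>, \<beta>)) = {\<alpha> u + lam (\<beta> u) | u. u \<in> U}"
  unfolding Phi_def
proof (rule some_equality)
  show "\<exists>\<alpha>' \<beta>'. \<alpha>' \<in> EndU sm U \<and> \<beta>' \<in> EndU sm U \<and>
      cyc (EndU sm U) rtimes (\<alpha>, \<beta>) = cyc (EndU sm U) rtimes (\<alpha>', \<beta>') \<and>
      {\<alpha> u + lam (\<beta> u) | u. u \<in> U} = {\<alpha>' u + lam (\<beta>' u) | u. u \<in> U}"
    using assms by blast
next
  fix X
  assume "\<exists>\<alpha>' \<beta>'. \<alpha>' \<in> EndU sm U \<and> \<beta>' \<in> EndU sm U \<and>
      cyc (EndU sm U) rtimes (\<alpha>, \<beta>) = cyc (EndU sm U) rtimes (\<alpha>', \<beta>') \<and>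
      X = {\<alpha>' u + lam (\<beta>' u) | u. u \<in> U}"
  then obtain \<alpha>' \<beta>' where *: "\<alpha>' \<in> EndU sm U" "\<beta>' \<in> EndU sm U"
    "cyc (EndU sm U) rtimes (\<alpha>, \<beta>) = cyc (EndU sm U) rtimes (\<alpha>', \<beta>')"
    "X = {\<alpha>' u + lam (\<beta>' u) | u. u \<in> U}" by blast
  have "(\<alpha>, \<beta>) \<in> cyc (EndU sm U) rtimes (\<alpha>', \<beta>')"
    "(\<alpha>', \<beta>') \<in> cyc (EndU sm U) rtimes (\<alpha>, \<beta>)"
    using cyc_self[OF assms] cyc_self[OF assms(1) *(1,2)] *(3) by simp_all
  then show "X = {\<alpha> u + lam (\<beta> u) | u. u \<in> U}"
    unfolding *(4) by (intro equalityI cyc_image_subset)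
qed

text \<open>Left multiplication is precomposition, which commutes with pointwise sums and with the
  composition by matrix entries.\<close>

lemma sub_act_cyc_rtimes:
  "sub_act rplus rtimes (cyc E rtimes v) M = cyc E rtimes (row_act rplus rtimes v M)"
  unfolding sub_act_def cyc_def row_act_def rplus_def rtimes_def
  by (cases v; cases M) (auto simp: comp_def image_def)

text \<open>A nonzero row over the field \<open>Z\<close> can be completed to an invertible matrix;
  conversely, the first row of an invertible matrix is nonzero and is a multiple of
  \<open>(x, y)\<close>.\<close>

lemma PZ_iff:
  fixes x y :: 'k
  assumes "x \<in> centre" "y \<in> centre"
  shows "cyc centre (*) (x, y) \<in> PZ \<longleftrightarrow> x \<noteq> 0 \<or> y \<noteq> 0"
proof
  assume "cyc centre (*) (x, y) \<in> PZ"
  then obtain a b c d a' b' c' d' :: 'k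
    where eq: "cyc centre (*) (x, y) = sub_act (+) (*) (cyc centre (*) (1, 0)) (a, b, c, d)"
      and "mat_mul (+) (*) (a, b, c, d) (a', b', c', d') = (1, 0, 0, 1)"
    unfolding PZ_def proj_line_def GL2_def by auto
  then have inv: "a * a' + b * c' = 1" by (simp add: mat_mul_def)
  have "(1, 0) \<in> cyc (centre :: 'k set) (*) (1, 0)"
    unfolding cyc_def by (auto intro: centre_1)
  then have "(a, b) \<in> cyc centre (*) (x, y)"
    unfolding eq sub_act_def by (force simp: row_act_def)
  then obtain r where "a = r * x" "b = r * y" unfolding cyc_def by auto
  with inv show "x \<noteq> 0 \<or> y \<noteq> 0" by auto
next
  assume nz: "x \<noteq> 0 \<or> y \<noteq> 0"
  obtain c d where M: "(x, y, c, d) \<in> GL2 centre (+) (*) 0 1"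
  proof (cases "x = 0")
    case True
    with nz have "y \<noteq> 0" by simp
    have "(0, y, 1, 0) \<in> GL2 centre (+) (*) 0 1"
      unfolding GL2_def using assms \<open>y \<noteq> 0\<close>
      by (intro CollectI conjI exI[of _ "(0, 1, inverse y, 0)"])
        (simp_all add: mat_in_def mat_mul_def centre_inverse)
    then show ?thesis by (intro that[of 1 0]) (simp add: True)
  next
    case False
    then have "(x, y, 0, 1) \<in> GL2 centre (+) (*) 0 1"
      unfolding GL2_def using assms
      by (intro CollectI conjI exI[of _ "(inverse x, - (inverse x * y), 0, 1)"])
        (simp_all add: mat_in_def mat_mul_def centre_inverse centre_minus centre_mult
          flip: mult.assoc)
    then show ?thesis by (rule that)
  qed
  have "cyc centre (*) (x, y) = sub_act (+) (*) (cyc centre (*) (1, 0)) (x, y, c, d)"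
    unfolding sub_act_def cyc_def row_act_def by (auto simp: image_def)
  with M show "cyc centre (*) (x, y) \<in> PZ"
    unfolding PZ_def proj_line_def by blast
qed

lemma PZ_emb_eq:
  "PZ_emb sm U = {cyc (EndU sm U) rtimes (zid sm U x, zid sm U y) | x y.
      x \<in> centre \<and> y \<in> centre \<and> (x \<noteq> 0 \<or> y \<noteq> 0)}"
  unfolding PZ_emb_def using PZ_iff by blast

text \<open>The rows of the matrix are the coordinates of \<open>f\<close> and of \<open>h\<close>
  after \<open>f\<close> in the frame \<open>(U, lam)\<close>. Thus the row \<open>(x, y)\<close>
  times the matrix describes \<open>u\<close> to \<open>pt h x y (f u)\<close>, whose image is
  \<open>rg A h x y\<close> because \<open>f\<close> is onto \<open>A\<close>.\<close>

lemma Phi_chain: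
  fixes a b c d :: "'v \<Rightarrow> 'v"
  assumes U: "frame sm U lam" and E: "mat_in (EndU sm U) (a, b, c, d)"
    and f: "bij_betw f U A" "\<And>u. u \<in> U \<Longrightarrow> f u = a u + lam (b u)"
    and hf: "\<And>u. u \<in> U \<Longrightarrow> h (f u) = c u + lam (d u)" and h: "lin_on sm A h"
  shows "Phi sm U lam ` (\<lambda>S. sub_act rplus rtimes S (a, b, c, d)) ` PZ_emb sm U = reg A h"
proof -
  note Us = frameD(1)[OF U] and lam = frameD(2)[OF U]
  have E': "a \<in> EndU sm U" "b \<in> EndU sm U" "c \<in> EndU sm U" "d \<in> EndU sm U"
    using E by (auto simp: mat_in_def)
  have img: "f ` U = A" using f(1) by (simp add: bij_betw_def)
  have "Phi sm U lam (sub_act rplus rtimes (cyc (EndU sm U) rtimes (zid sm U x, zid sm U y)) (a, b, c, d))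
      = rg A h x y" if xy: "x \<in> centre" "y \<in> centre" for x y
  proof -
    let ?\<alpha> = "rplus (rtimes (zid sm U x) a) (rtimes (zid sm U y) c)"
      and ?\<beta> = "rplus (rtimes (zid sm U x) b) (rtimes (zid sm U y) d)"
    have mem: "?\<alpha> \<in> EndU sm U" "?\<beta> \<in> EndU sm U"
      using E' xy by (auto intro!: EndU_rplus EndU_rtimes zid_EndU Us)
    have pt: "?\<alpha> u + lam (?\<beta> u) = pt h x y (f u)" if u: "u \<in> U" for u
    proof -
      have "?\<alpha> u + lam (?\<beta> u)
          = (sm x (a u) + sm y (c u)) + lam (sm x (b u) + sm y (d u))"
        using u by (simp add: rplus_def rtimes_def zid_def EndU_sm[OF E'(1)] EndU_sm[OF E'(2)]
            EndU_sm[OF E'(3)] EndU_sm[OF E'(4)])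
      also have "\<dots> = sm x (a u + lam (b u)) + sm y (c u + lam (d u))"
        using EndU_in[OF E'(2) u] EndU_in[OF E'(4) u]
        by (simp add: lin_on_add[OF lam] lin_on_sm[OF lam] subspace_sm[OF Us] sm_add_right
            algebra_simps)
      also have "\<dots> = pt h x y (f u)"
        using u img unfolding pt_def f(2)[OF u, symmetric] hf[OF u, symmetric]
        by (subst lin_on_sm[OF h]) auto
      finally show ?thesis .
    qed
    have "{?\<alpha> u + lam (?\<beta> u) | u. u \<in> U} = rg A h x y"
      unfolding rg_def img[symmetric] using pt by (auto simp: image_iff) metis
    then show ?thesis
      unfolding sub_act_cyc_rtimes by (simp add: row_act_def Phi_cyc[OF Us mem])
  qed
  then show ?thesis
    unfolding PZ_emb_eq reg_def by (auto simp: image_iff) metis+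
qed

text \<open>The maps \<open>f\<close> and \<open>h\<close> after \<open>f\<close> identify
  \<open>V\<close> with \<open>U x U\<close>, and the two components of a linear map from
  \<open>U\<close> are endomorphisms of \<open>U\<close> by uniqueness of coordinates. Applied to
  the rows of a matrix and of its inverse.\<close>

lemma frame_coordinates:
  assumes U: "subspace sm U" and fr: "frame sm A h" and f: "lin_on sm U f" "bij_betw f U A"
    and g: "lin_on sm U g"
  obtains a b where "a \<in> EndU sm U" "b \<in> EndU sm U" "\<And>u. u \<in> U \<Longrightarrow> g u = f (a u) + h (f (b u))"
proof -
  note h = frameD(2)[OF fr]
  have fA: "f u \<in> A" if "u \<in> U" for u using f(2) that by (auto simp: bij_betw_def)
  have "\<exists>p\<in>U. \<exists>q\<in>U. v = f p + h (f q)" for v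
  proof -
    obtain x y where "x \<in> A" "y \<in> A" "v = x + h y" using frame_decomp[OF fr] .
    with f(2) show ?thesis unfolding bij_betw_def by blast
  qed
  then obtain p q where pq: "\<And>v. p v \<in> U" "\<And>v. q v \<in> U" "\<And>v. v = f (p v) + h (f (q v))"
    by metis
  have uniq: "p v = x \<and> q v = y" if "x \<in> U" "y \<in> U" "v = f x + h (f y)" for v x y
  proof -
    have "f (p v) + h (f (q v)) = f x + h (f y)" using pq(3)[of v] that(3) by simp
    then have "f (p v) = f x" "f (q v) = f y"
      using frame_eq[OF fr fA[OF pq(1)] fA[OF pq(2)] fA[OF that(1)] fA[OF that(2)]] by blast+
    then show ?thesis using f(2) that(1,2) pq(1,2) unfolding bij_betw_def by (meson inj_onD)
  qed
  have add: "p (v + w) = p v + p w \<and> q (v + w) = q v + q w" for v w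
  proof (rule uniq)
    have "v + w = (f (p v) + h (f (q v))) + (f (p w) + h (f (q w)))"
      using pq(3) by metis
    then show "v + w = f (p v + p w) + h (f (q v + q w))"
      using pq(1,2) fA by (simp add: lin_on_add[OF f(1)] lin_on_add[OF h] algebra_simps)
  qed (auto intro: subspace_add[OF U] pq)
  have scale: "p (sm s v) = sm s (p v) \<and> q (sm s v) = sm s (q v)" for s v
  proof (rule uniq)
    have "sm s v = sm s (f (p v) + h (f (q v)))" using pq(3) by metis
    then show "sm s v = f (sm s (p v)) + h (f (sm s (q v)))"
      using pq(1,2) fA by (simp add: lin_on_sm[OF f(1)] lin_on_sm[OF h] sm_add_right)
  qed (auto intro: subspace_sm[OF U] pq)
  \<comment> \<open>The components are cut off to 0 outside \<open>U\<close>, as the representation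
    of endomorphisms demands.\<close>
  let ?a = "\<lambda>u. if u \<in> U then p (g u) else 0" and ?b = "\<lambda>u. if u \<in> U then q (g u) else 0"
  have "lin_on sm U ?a" "lin_on sm U ?b"
    using add scale by (auto simp: lin_on_def lin_on_add[OF g] lin_on_sm[OF g]
        subspace_add[OF U] subspace_sm[OF U])
  then have "?a \<in> EndU sm U" "?b \<in> EndU sm U"
    using pq(1,2) by (auto simp: EndU_iff)
  moreover have "g u = f (?a u) + h (f (?b u))" if "u \<in> U" for u
    using pq(3)[of "g u"] that by simp
  ultimately show thesis by (rule that)
qed

lemma mat_mul_eq_oneI:
  assumes "subspace sm U" "mat_in (EndU sm U) (a, b, c, d)" "mat_in (EndU sm U) (a', b', c', d')"
    and "\<And>u. u \<in> U \<Longrightarrow> a' (a u) + c' (b u) = u \<and> b' (a u) + d' (b u) = 0"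
    and "\<And>u. u \<in> U \<Longrightarrow> a' (c u) + c' (d u) = 0 \<and> b' (c u) + d' (d u) = u"
  shows "mat_mul rplus rtimes (a, b, c, d) (a', b', c', d') = (rone U, rzero, rzero, rone U)"
proof -
  have E: "a \<in> EndU sm U" "b \<in> EndU sm U" "c \<in> EndU sm U" "d \<in> EndU sm U"
    "a' \<in> EndU sm U" "b' \<in> EndU sm U" "c' \<in> EndU sm U" "d' \<in> EndU sm U"
    using assms(2,3) by (simp_all add: mat_in_def)
  have out: "a u = 0" "b u = 0" "c u = 0" "d u = 0" if "u \<notin> U" for u
    by (rule E[THEN EndU_out, OF that])+
  note zero = E(5-8)[THEN EndU_0, OF assms(1)]
  have "a' (a u) + c' (b u) = (if u \<in> U then u else 0)" "b' (a u) + d' (b u) = 0"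
    "a' (c u) + c' (d u) = 0" "b' (c u) + d' (d u) = (if u \<in> U then u else 0)" for u
    using assms(4,5)[of u] by (cases "u \<in> U"; simp add: out zero)+
  then show ?thesis
    by (simp add: mat_mul_def rplus_def rtimes_def rone_def rzero_def fun_eq_iff)
qed

lemma mat_mul_eq_oneD:
  assumes "mat_mul rplus rtimes (a, b, c, d) (a', b', c', d') = (rone U, rzero, rzero, rone U)"
    and "u \<in> U"
  shows "a' (a u) + c' (b u) = u" "b' (a u) + d' (b u) = 0"
    "a' (c u) + c' (d u) = 0" "b' (c u) + d' (d u) = u"
  using assms by (auto simp: mat_mul_def rplus_def rtimes_def rone_def rzero_def fun_eq_iff)

text \<open>The change-of-basis matrix between two identifications of \<open>V\<close> with
  \<open>U x U\<close>: by the identity and \<open>lam\<close>, and by \<open>f\<close> and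
  \<open>h\<close> after \<open>f\<close>.\<close>

lemma matrix_of_frame:
  assumes U: "frame sm U lam" and fr: "frame sm A h" and f: "lin_on sm U f" "bij_betw f U A"
  obtains a b c d where "(a, b, c, d) \<in> GL2 (EndU sm U) rplus rtimes rzero (rone U)"
    "\<And>u. u \<in> U \<Longrightarrow> f u = a u + lam (b u)" "\<And>u. u \<in> U \<Longrightarrow> h (f u) = c u + lam (d u)"
proof -
  note Us = frameD(1)[OF U] and lam = frameD(2)[OF U] and h = frameD(2)[OF fr]
  have fA: "f u \<in> A" if "u \<in> U" for u using f(2) that by (auto simp: bij_betw_def)
  have img: "f ` U = A" using f(2) by (simp add: bij_betw_def)
  have idU: "lin_on sm U (\<lambda>u. u)" by (simp add: lin_on_def)
  have hf: "lin_on sm U (\<lambda>u. h (f u))"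
    using lin_on_comp[OF f(1), of h] h img by simp
  have idbij: "bij_betw (\<lambda>u. u) U U" by (simp add: bij_betw_def)
  obtain a b where ab: "a \<in> EndU sm U" "b \<in> EndU sm U" "\<And>u. u \<in> U \<Longrightarrow> f u = a u + lam (b u)"
    by (rule frame_coordinates[OF Us U idU idbij f(1)]) blast
  obtain c d where cd: "c \<in> EndU sm U" "d \<in> EndU sm U" "\<And>u. u \<in> U \<Longrightarrow> h (f u) = c u + lam (d u)"
    by (rule frame_coordinates[OF Us U idU idbij hf]) blast
  \<comment> \<open>The inverse matrix: coordinates of the identity and of \<open>lam\<close> with
    respect to \<open>f\<close> and \<open>h\<close> after \<open>f\<close>.\<close>
  obtain a' b' where ab': "a' \<in> EndU sm U" "b' \<in> EndU sm U"
    "\<And>u. u \<in> U \<Longrightarrow> u = f (a' u) + h (f (b' u))"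
    by (rule frame_coordinates[OF Us fr f idU]) blast
  obtain c' d' where cd': "c' \<in> EndU sm U" "d' \<in> EndU sm U"
    "\<And>u. u \<in> U \<Longrightarrow> lam u = f (c' u) + h (f (d' u))"
    by (rule frame_coordinates[OF Us fr f lam]) blast
  note mem = EndU_in[OF ab(1)] EndU_in[OF ab(2)] EndU_in[OF cd(1)] EndU_in[OF cd(2)]
    EndU_in[OF ab'(1)] EndU_in[OF ab'(2)] EndU_in[OF cd'(1)] EndU_in[OF cd'(2)]
  have uniqU: "x = x' \<and> y = y'"
    if "x \<in> U" "y \<in> U" "x' \<in> U" "y' \<in> U" "x + lam y = x' + lam y'" for x y x' y'
    using frame_eq[OF U that] by blast
  have uniqA: "x = x' \<and> y = y'"
    if "x \<in> U" "y \<in> U" "x' \<in> U" "y' \<in> U" "f x + h (f y) = f x' + h (f y')" for x y x' y'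
    using frame_eq[OF fr fA[OF that(1)] fA[OF that(2)] fA[OF that(3)] fA[OF that(4)] that(5)]
      f(2) that(1-4) unfolding bij_betw_def by (meson inj_onD)
  have z: "0 \<in> U" by (rule subspace_0[OF Us])
  have l0: "lam 0 = 0" and f0: "f 0 = 0" and h0: "h 0 = 0"
    using lin_on_0[OF lam Us] lin_on_0[OF f(1) Us] lin_on_0[OF h frameD(1)[OF fr]] by auto
  have U_exp: "f x + h (f y) = (a x + c y) + lam (b x + d y)" if "x \<in> U" "y \<in> U" for x y
    using that ab(3) cd(3) mem by (simp add: lin_on_add[OF lam] algebra_simps)
  have A_exp: "x + lam y = f (a' x + c' y) + h (f (b' x + d' y))" if "x \<in> U" "y \<in> U" for x y
  proof -
    have "x + lam y = (f (a' x) + h (f (b' x))) + (f (c' y) + h (f (d' y)))"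
      using that ab'(3) cd'(3) by metis
    then show ?thesis
      using that mem fA by (simp add: lin_on_add[OF f(1)] lin_on_add[OF h] algebra_simps)
  qed
  have M: "mat_in (EndU sm U) (a, b, c, d)" and N: "mat_in (EndU sm U) (a', b', c', d')"
    using ab cd ab' cd' by (auto simp: mat_in_def)
  have "mat_mul rplus rtimes (a, b, c, d) (a', b', c', d') = (rone U, rzero, rzero, rone U)"
  proof (rule mat_mul_eq_oneI[OF Us M N])
    fix u assume u: "u \<in> U"
    note mem' = mem(1-4)[OF u] and in' = mem(5-8)
    have "f (a' (a u) + c' (b u)) + h (f (b' (a u) + d' (b u))) = f u + h (f 0)"
      unfolding A_exp[OF mem'(1,2), symmetric] using ab(3)[OF u] f0 h0 by simp
    then show "a' (a u) + c' (b u) = u \<and> b' (a u) + d' (b u) = 0"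
      by (rule uniqA[rotated 4]) (intro u z mem' in' subspace_add[OF Us])+
    have "f (a' (c u) + c' (d u)) + h (f (b' (c u) + d' (d u))) = f 0 + h (f u)"
      unfolding A_exp[OF mem'(3,4), symmetric] using cd(3)[OF u] f0 by simp
    then show "a' (c u) + c' (d u) = 0 \<and> b' (c u) + d' (d u) = u"
      by (rule uniqA[rotated 4]) (intro u z mem' in' subspace_add[OF Us])+
  qed
  moreover have "mat_mul rplus rtimes (a', b', c', d') (a, b, c, d) = (rone U, rzero, rzero, rone U)"
  proof (rule mat_mul_eq_oneI[OF Us N M])
    fix u assume u: "u \<in> U"
    note mem' = mem(5-8)[OF u] and in' = mem(1-4)
    have "(a (a' u) + c (b' u)) + lam (b (a' u) + d (b' u)) = u + lam 0"
      unfolding U_exp[OF mem'(1,2), symmetric] using ab'(3)[OF u] l0 by simp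
    then show "a (a' u) + c (b' u) = u \<and> b (a' u) + d (b' u) = 0"
      by (rule uniqU[rotated 4]) (intro u z mem' in' subspace_add[OF Us])+
    have "(a (c' u) + c (d' u)) + lam (b (c' u) + d (d' u)) = 0 + lam u"
      unfolding U_exp[OF mem'(3,4), symmetric] using cd'(3)[OF u] by simp
    then show "a (c' u) + c (d' u) = 0 \<and> b (c' u) + d (d' u) = u"
      by (rule uniqU[rotated 4]) (intro u z mem' in' subspace_add[OF Us])+
  qed
  ultimately have "(a, b, c, d) \<in> GL2 (EndU sm U) rplus rtimes rzero (rone U)"
    unfolding GL2_def using M N by blast
  then show thesis using ab(3) cd(3) by (rule that)
qed

text \<open>The rows define maps \<open>?f\<close> and \<open>?g\<close> from \<open>U\<close> to
  \<open>V\<close>, and \<open>h\<close> carries \<open>?f u\<close> to \<open>?g u\<close>. The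
  product of the matrix with its inverse in one order gives injectivity and trivial intersection, in
  the other order generation of \<open>V\<close>.\<close>

lemma frame_of_matrix:
  assumes U: "frame sm U lam" and M: "(a, b, c, d) \<in> GL2 (EndU sm U) rplus rtimes rzero (rone U)"
  obtains A h f where "frame sm A h" "bij_betw f U A"
    "\<And>u. u \<in> U \<Longrightarrow> f u = a u + lam (b u)" "\<And>u. u \<in> U \<Longrightarrow> h (f u) = c u + lam (d u)"
proof -
  note Us = frameD(1)[OF U] and lam = frameD(2)[OF U]
  from M obtain a' b' c' d' where E: "mat_in (EndU sm U) (a, b, c, d)"
      "mat_in (EndU sm U) (a', b', c', d')"
    and MN: "mat_mul rplus rtimes (a, b, c, d) (a', b', c', d') = (rone U, rzero, rzero, rone U)"
    and NM: "mat_mul rplus rtimes (a', b', c', d') (a, b, c, d) = (rone U, rzero, rzero, rone U)"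
    unfolding GL2_def by auto
  have E': "a \<in> EndU sm U" "b \<in> EndU sm U" "c \<in> EndU sm U" "d \<in> EndU sm U"
    "a' \<in> EndU sm U" "b' \<in> EndU sm U" "c' \<in> EndU sm U" "d' \<in> EndU sm U"
    using E by (auto simp: mat_in_def)
  note mem = E'[THEN EndU_in] and add = E'[THEN EndU_add] and zero = E'[THEN EndU_0, OF Us]
  let ?f = "\<lambda>u. a u + lam (b u)" and ?g = "\<lambda>u. c u + lam (d u)"
  have lin: "lin_on sm U ?f" "lin_on sm U ?g"
    using mem by (auto simp: lin_on_def add E'[THEN EndU_sm] lin_on_add[OF lam] lin_on_sm[OF lam]
        sm_add_right algebra_simps)
  \<comment> \<open>The row \<open>(u, w)\<close> times the matrix is zero, so multiplication by the
    inverse gives \<open>(u, w) = 0\<close>. This covers injectivity of \<open>?f\<close> and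
    \<open>?g\<close> as well as their images meeting trivially.\<close>
  have fg0: "u = 0 \<and> w = 0" if "u \<in> U" "w \<in> U" "?f u + ?g w = 0" for u w
  proof -
    have exp: "(a u + c w) + lam (b u + d w) = 0"
      using that mem by (simp add: lin_on_add[OF lam] algebra_simps)
    have "a u + c w \<in> U" "b u + d w \<in> U"
      by (intro subspace_add[OF Us] mem that(1,2))+
    from frame_eq_0[OF U this exp] have 0: "a u + c w = 0" "b u + d w = 0" .
    have "u = (a' (a u) + c' (b u)) + (a' (c w) + c' (d w))"
      using mat_mul_eq_oneD[OF MN] that by simp
    also have "\<dots> = a' (a u + c w) + c' (b u + d w)"
      using that mem by (simp add: add algebra_simps)
    finally have "u = 0" unfolding 0 by (simp add: zero)
    have "w = (b' (a u) + d' (b u)) + (b' (c w) + d' (d w))"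
      using mat_mul_eq_oneD[OF MN] that by simp
    also have "\<dots> = b' (a u + c w) + d' (b u + d w)"
      using that mem by (simp add: add algebra_simps)
    finally have "w = 0" unfolding 0 by (simp add: zero)
    with \<open>u = 0\<close> show ?thesis by blast
  qed
  have f0: "?f 0 = 0" and g0: "?g 0 = 0"
    using lin_on_0[OF lin(1) Us] lin_on_0[OF lin(2) Us] by auto
  have inj: "inj_on ?f U" "inj_on ?g U"
    unfolding lin_on_inj_iff[OF lin(1) Us] lin_on_inj_iff[OF lin(2) Us]
    using fg0[of _ 0] fg0[of 0] subspace_0[OF Us] f0 g0 by auto
  have dist: "distant (?f ` U) (?g ` U)"
  proof (rule distantI)
    show "subspace sm (?f ` U)" "subspace sm (?g ` U)"
      by (rule lin_on_image[OF lin(1) Us] lin_on_image[OF lin(2) Us])+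
    show "v = 0" if v: "v \<in> ?f ` U" "v \<in> ?g ` U" for v
    proof -
      from v obtain u w where uw: "u \<in> U" "w \<in> U" "v = ?f u" "v = ?g w" by blast
      then have "?f u + ?g (- w) = 0"
        using lin_on_minus[OF lin(2) uw(2)] by simp
      then have "u = 0" using fg0[OF uw(1) subspace_minus[OF Us uw(2)]] by blast
      then show ?thesis using uw f0 by simp
    qed
    show "\<exists>x\<in>?f ` U. \<exists>y\<in>?g ` U. v = x + y" for v
    proof -
      obtain p q where pq: "p \<in> U" "q \<in> U" "v = p + lam q" using frame_decomp[OF U] .
      \<comment> \<open>The row \<open>(p, q)\<close> times the inverse matrix.\<close>
      let ?u = "a' p + c' q" and ?w = "b' p + d' q"
      have uw: "?u \<in> U" "?w \<in> U"
        by (intro subspace_add[OF Us] mem pq(1,2))+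
      have "(a (a' p) + c (b' p)) + (a (c' q) + c (d' q)) = p"
        and "(b (a' p) + d (b' p)) + (b (c' q) + d (d' q)) = q"
        using mat_mul_eq_oneD[OF NM] pq(1,2) by simp_all
      then have "a ?u + c ?w = p" "b ?u + d ?w = q"
        using pq(1,2) mem by (simp_all add: add algebra_simps)
      then have "v = (a ?u + c ?w) + lam (b ?u + d ?w)"
        using pq(3) by simp
      also have "\<dots> = ?f ?u + ?g ?w"
        using uw mem by (simp add: lin_on_add[OF lam] algebra_simps)
      finally show ?thesis using uw by blast
    qed
  qed
  let ?h = "\<lambda>v. ?g (inv_into U ?f v)"
  have hf: "?h (?f u) = ?g u" if "u \<in> U" for u
    using inv_into_f_f[OF inj(1) that] by simp
  have invU: "inv_into U ?f ` ?f ` U = U"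
    by (rule inv_into_image_cancel[OF inj(1) order_refl])
  have "?h ` ?f ` U = ?g ` U"
    using hf by (auto simp: image_iff)
  moreover have "lin_on sm (?f ` U) ?h"
    using lin_on_comp[OF lin_on_inv_into[OF lin(1) Us inj(1)], of ?g] lin(2) unfolding invU by blast
  moreover have "inj_on ?h (?f ` U)"
    using comp_inj_on[OF inj_on_inv_into[of "?f ` U" ?f U], of ?g] inj(2) unfolding invU
    by (simp add: comp_def)
  ultimately have "frame sm (?f ` U) ?h"
    unfolding frame_def using dist lin_on_image[OF lin(1) Us] by simp
  moreover have "bij_betw ?f U (?f ` U)" using inj(1) by (simp add: bij_betw_def)
  ultimately show thesis using hf that by blast
qed

text \<open>For a given frame \<open>(A, h)\<close>, any isomorphism \<open>f\<close> from
  \<open>U\<close> to \<open>A\<close> yields a suitable matrix: a different \<open>f\<close> may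
  change the matrix but not the family that is the image of its chain.\<close>

lemma Phi_Z_chains:
  assumes U: "frame sm U lam"
  shows "{Phi sm U lam ` C | C. C \<in> Z_chains sm U} = {reg A h | A h. frame sm A h}"
proof (intro equalityI subsetI)
  fix Rg assume "Rg \<in> {Phi sm U lam ` C | C. C \<in> Z_chains sm U}"
  then obtain a b c d where M: "(a, b, c, d) \<in> GL2 (EndU sm U) rplus rtimes rzero (rone U)"
    and Rg: "Rg = Phi sm U lam ` (\<lambda>S. sub_act rplus rtimes S (a, b, c, d)) ` PZ_emb sm U"
    unfolding Z_chains_def by auto
  obtain A h f where *: "frame sm A h" "bij_betw f U A"
    "\<And>u. u \<in> U \<Longrightarrow> f u = a u + lam (b u)" "\<And>u. u \<in> U \<Longrightarrow> h (f u) = c u + lam (d u)"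
    by (rule frame_of_matrix[OF U M]) blast
  have "mat_in (EndU sm U) (a, b, c, d)" using M by (simp add: GL2_def)
  then have "Rg = reg A h"
    unfolding Rg using Phi_chain[OF U _ *(2-4) frameD(2)[OF *(1)]] by blast
  with *(1) show "Rg \<in> {reg A h | A h. frame sm A h}" by blast
next
  fix Rg assume "Rg \<in> {reg A h | A h. frame sm A h}"
  then obtain A h where fr: "frame sm A h" and Rg: "Rg = reg A h" by blast
  obtain f where f: "lin_on sm U f" "bij_betw f U A" using frames_iso[OF U fr] .
  obtain a b c d where M: "(a, b, c, d) \<in> GL2 (EndU sm U) rplus rtimes rzero (rone U)"
    and *: "\<And>u. u \<in> U \<Longrightarrow> f u = a u + lam (b u)" "\<And>u. u \<in> U \<Longrightarrow> h (f u) = c u + lam (d u)"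
    by (rule matrix_of_frame[OF U fr f]) blast
  have "mat_in (EndU sm U) (a, b, c, d)" using M by (simp add: GL2_def)
  then have "Rg = Phi sm U lam ` (\<lambda>S. sub_act rplus rtimes S (a, b, c, d)) ` PZ_emb sm U"
    unfolding Rg using Phi_chain[OF U _ f(2) * frameD(2)[OF fr]] by blast
  with M show "Rg \<in> {Phi sm U lam ` C | C. C \<in> Z_chains sm U}"
    unfolding Z_chains_def by blast
qed

end

theorem theorem4p5:
  fixes sm :: "'k::division_ring \<Rightarrow> 'v::ab_group_add \<Rightarrow> 'v"
    and U U' :: "'v set" and lam :: "'v \<Rightarrow> 'v"
  assumes "left_vs sm"
    and "dim_gt2 sm"
    and "Gset sm \<noteq> {}"
    and "U \<in> Gset sm" and "U' \<in> Gset sm" and "distant U U'"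
    and "\<forall>x\<in>U. \<forall>y\<in>U. lam (x + y) = lam x + lam y"
    and "\<forall>a. \<forall>x\<in>U. lam (sm a x) = sm a (lam x)"
    and "bij_betw lam U U'"
  shows "{Phi sm U lam ` C | C. C \<in> Z_chains sm U} = {Rg. Z_regulus sm Rg}"
proof -
  interpret left_space sm by unfold_locales (rule assms(1))
  have U: "frame sm U lam"
    using assms(4,6-9) by (auto simp: frame_def lin_on_def Gset_def bij_betw_def)
  show ?thesis
    unfolding Phi_Z_chains[OF U] by (auto simp: Z_regulus_iff[OF assms(2)])
qed

end
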